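(* Let $V\in C^\infty([0,1];\mathbb{R})$, let $k\ge1$, and let $u\in C^0(\mathbb{R};H^{2k})\cap C^1(\mathbb{R};H^{2k-2})$ be a solution to $$\mathrm{i}\partial_tu=(\partial_x^2+V)u\quad\text{in }\mathbb{R}\times(0,1),\qquad u(\cdot,0)=u(\cdot,1)=0\quad\text{in }\mathbb{R}.$$ Then for all integers $0\le j\le k$, $u\in C^j(\mathbb{R};H^{2k-2j}_V)$, where for all $a\ge0$ $$H^{2a}_V=\{u\in H^{2a}:\ \forall\,0\le\ell<a,\ (\partial_x^2+V)^\ell u(0)=(\partial_x^2+V)^\ell u(1)=0\}.$$
   Context: $H^m=\{u\in L^2([0,1];\mathbb{C}):\partial_x^\ell u\in L^2([0,1];\mathbb{C})\ \forall \ell\le m\}$ is the usual Sobolev space on $[0,1]$. $H^{2a}_V$ carries the $H^{2a}$ norm, and $H^0_V=L^2$. *)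

theory Defs
  imports "HOL-Analysis.Analysis"
begin

text \<open>
  Elements of \<open>L\<^sup>2([0,1];\<complex>)\<close> are represented by functions \<open>real \<Rightarrow> complex\<close>; every notion
  below depends only on the class of the function modulo equality almost everywhere on
  \<open>[0,1]\<close> (the space norms are seminorms on representatives).
\<close>

abbreviation leb01 :: "real measure"
  where "leb01 \<equiv> lebesgue_on {0..1}"

definition L2 :: "(real \<Rightarrow> complex) set"
  where "L2 = {f. f \<in> borel_measurable leb01 \<and> integrable leb01 (\<lambda>x. (cmod (f x))\<^sup>2)}"

text \<open>On \<open>S = {0..1}\<close> the derivatives at the endpoints are one-sided.\<close>

definition smooth_on :: "real set \<Rightarrow> (real \<Rightarrow> real) \<Rightarrow> bool"
  where "smooth_on S f \<longleftrightarrow>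
    (\<exists>D. (\<forall>x\<in>S. D 0 x = f x) \<and>
         (\<forall>n. \<forall>x\<in>S. (D n has_real_derivative D (Suc n) x) (at x within S)))"

definition test_function :: "(real \<Rightarrow> real) \<Rightarrow> bool"
  where "test_function \<phi> \<longleftrightarrow> smooth_on UNIV \<phi> \<and> closure {x. \<phi> x \<noteq> 0} \<subseteq> {0<..<1}"

definition weak_deriv :: "nat \<Rightarrow> (real \<Rightarrow> complex) \<Rightarrow> (real \<Rightarrow> complex) \<Rightarrow> bool"
  where "weak_deriv l f g \<longleftrightarrow>
    (\<forall>\<phi>. test_function \<phi> \<longrightarrow>
      (LINT x|leb01. f x * of_real ((deriv ^^ l) \<phi> x)) =
      (-1) ^ l * (LINT x|leb01. g x * of_real (\<phi> x)))"

definition sobolev :: "nat \<Rightarrow> (real \<Rightarrow> complex) set"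
  where "sobolev m = {f \<in> L2. \<forall>l\<le>m. \<exists>g\<in>L2. weak_deriv l f g}"

text \<open>A representative of \<open>\<partial>\<^sub>x\<^sup>l f\<close>, meaningful for \<open>f \<in> sobolev m\<close> with \<open>l \<le> m\<close>.\<close>

definition wderiv :: "nat \<Rightarrow> (real \<Rightarrow> complex) \<Rightarrow> real \<Rightarrow> complex"
  where "wderiv l f = (SOME g. g \<in> L2 \<and> weak_deriv l f g)"

definition sobolev_norm :: "nat \<Rightarrow> (real \<Rightarrow> complex) \<Rightarrow> real"
  where "sobolev_norm m f = sqrt (\<Sum>l\<le>m. LINT x|leb01. (cmod (wderiv l f x))\<^sup>2)"

text \<open>
  The value at a point is that of the continuous representative, which is unique on
  \<open>[0,1]\<close> and exists for every \<open>f \<in> sobolev m\<close> with \<open>m \<ge> 1\<close>.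
\<close>

definition has_point_value :: "(real \<Rightarrow> complex) \<Rightarrow> real \<Rightarrow> complex \<Rightarrow> bool"
  where "has_point_value f p c \<longleftrightarrow>
    (\<exists>g. continuous_on {0..1} g \<and> (AE x in leb01. f x = g x) \<and> g p = c)"

definition schroedinger_op :: "(real \<Rightarrow> real) \<Rightarrow> (real \<Rightarrow> complex) \<Rightarrow> real \<Rightarrow> complex"
  where "schroedinger_op V f = (\<lambda>x. wderiv 2 f x + of_real (V x) * f x)"

text \<open>\<open>sobolev_V V a\<close> is \<open>H\<^sup>2\<^sup>a\<^sub>V\<close>; the regularity index is \<open>2 * a\<close>.\<close>

definition sobolev_V :: "(real \<Rightarrow> real) \<Rightarrow> nat \<Rightarrow> (real \<Rightarrow> complex) set"
  where "sobolev_V V a = {f \<in> sobolev (2 * a). \<forall>l<a.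
    has_point_value ((schroedinger_op V ^^ l) f) 0 0 \<and>
    has_point_value ((schroedinger_op V ^^ l) f) 1 0}"

definition has_time_deriv ::
    "nat \<Rightarrow> (real \<Rightarrow> real \<Rightarrow> complex) \<Rightarrow> (real \<Rightarrow> complex) \<Rightarrow> real \<Rightarrow> bool"
  where "has_time_deriv m u v t \<longleftrightarrow>
    ((\<lambda>s. sobolev_norm m (\<lambda>x. (u s x - u t x) / of_real (s - t) - v x)) \<longlongrightarrow> 0) (at t)"

text \<open>
  \<open>C_time j X m\<close> is \<open>C\<^sup>j(\<real>; X)\<close> for a subspace \<open>X\<close> of \<open>sobolev m\<close> carrying the norm of
  \<open>sobolev m\<close>; the function \<open>D i\<close> is the \<open>i\<close>-th time derivative.
\<close>

definition C_time :: "nat \<Rightarrow> (real \<Rightarrow> complex) set \<Rightarrow> nat \<Rightarrow> (real \<Rightarrow> real \<Rightarrow> complex) set"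
  where "C_time j X m = {u. \<exists>D. D 0 = u \<and>
    (\<forall>i\<le>j. \<forall>t. D i t \<in> X \<and>
       ((\<lambda>s. sobolev_norm m (\<lambda>x. D i s x - D i t x)) \<longlongrightarrow> 0) (at t)) \<and>
    (\<forall>i<j. \<forall>t. has_time_deriv m (D i) (D (Suc i) t) t)}"

definition time_deriv :: "nat \<Rightarrow> (real \<Rightarrow> real \<Rightarrow> complex) \<Rightarrow> real \<Rightarrow> real \<Rightarrow> complex"
  where "time_deriv m u t = (SOME v. v \<in> sobolev m \<and> has_time_deriv m u v t)"

end

theory Submission
  imports Defs "HOL-Computational_Algebra.Polynomial"
begin

text \<open>
Write \<open>A = \<partial>\<^sub>x\<^sup>2 + V\<close> and \<open>B = - \<i> A\<close>, so that the equation reads \<open>\<partial>\<^sub>t u = B u\<close>. The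
time derivatives of \<open>u\<close> are then forced to be \<open>D\<^sub>i = B^i u\<close>, and these functions are the
witnesses for \<open>C_time\<close>.

Regularity comes from one estimate: \<open>B\<close> is a bounded linear map from \<open>H^(m+2)\<close> to \<open>H^m\<close>
(\<open>generator_bounded\<close>). Applied to a curve that is continuous in \<open>H^(m+2)\<close>, it gives a curve that
is continuous in \<open>H^m\<close>; applied to difference quotients that converge in \<open>H^(m+2)\<close>, it gives
difference quotients that converge in \<open>H^m\<close>. The given solution is continuous in \<open>H^(2k)\<close> and has
time derivative \<open>B u\<close> in \<open>H^(2k-2)\<close>. By induction on \<open>i\<close>, \<open>D\<^sub>i\<close> is therefore continuous in
\<open>H^(2(k-i))\<close> for \<open>i \<le> k\<close>, and for \<open>i < k\<close> it has time derivative \<open>D\<^bsub>i+1\<^esub>\<close> in \<open>H^(2(k-i-1))\<close>.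

The boundary conditions come from differentiating \<open>u(t,p) = 0\<close> in time. As long as \<open>i + 1 < k\<close>,
the difference quotients of \<open>D\<^sub>i\<close> converge at least in \<open>H^2\<close>, where the value at an endpoint is a
continuous functional (\<open>point_value_bound\<close>); if \<open>D\<^sub>i\<close> vanishes at the endpoints at all times, so do
these quotients and their limit \<open>D\<^bsub>i+1\<^esub>\<close>. Since \<open>A^l D\<^sub>i = \<i>^l D\<^bsub>i+l\<^esub>\<close>, this gives the conditions
that define \<open>sobolev_V\<close>.

What remains is Sobolev theory on an interval. It rests on the fundamental lemma of the calculus of
variations (\<open>fundamental_lemma\<close>): it makes weak derivatives unique almost everywhere, so that the
representatives chosen by \<open>wderiv\<close> obey the usual rules, and it yields the du Bois-Reymond lemma,
hence the representation of an \<open>H^1\<close> function as a constant plus the primitive of its weak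
derivative (\<open>weak_deriv_eq_primitive\<close>), on which point values depend.
\<close>

section \<open>Smooth functions and test functions\<close>

text \<open>
Smoothness is the largest property of functions that is stable under differentiation. Exhibiting a
stable class avoids writing down all derivatives of a function explicitly.
\<close>

lemma smooth_on_coinduct:
  assumes "P f"
    and step: "\<And>f. P f \<Longrightarrow> \<exists>g. P g \<and> (\<forall>x\<in>S. (f has_real_derivative g x) (at x within S))"
  shows "smooth_on S f"
proof -
  define N where "N f = (SOME g. P g \<and> (\<forall>x\<in>S. (f has_real_derivative g x) (at x within S)))" for f
  have N: "P (N g) \<and> (\<forall>x\<in>S. (g has_real_derivative N g x) (at x within S))" if "P g" for g
    unfolding N_def by (rule someI_ex[OF step[OF that]])
  have P: "P ((N ^^ n) f)" for n
    by (induction n) (use \<open>P f\<close> N in auto)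
  show ?thesis
    unfolding smooth_on_def
    by (rule exI[of _ "\<lambda>n. (N ^^ n) f"]) (use N[OF P] in auto)
qed

lemma smooth_on_derivative:
  assumes "smooth_on S f"
  obtains g where "smooth_on S g" "\<And>x. x \<in> S \<Longrightarrow> (f has_real_derivative g x) (at x within S)"
proof -
  from assms obtain D where D: "\<forall>x\<in>S. D 0 x = f x"
    "\<forall>n. \<forall>x\<in>S. (D n has_real_derivative D (Suc n) x) (at x within S)"
    unfolding smooth_on_def by blast
  show thesis
  proof
    show "smooth_on S (D 1)"
      unfolding smooth_on_def by (rule exI[of _ "\<lambda>n. D (Suc n)"]) (use D in auto)
    show "(f has_real_derivative D 1 x) (at x within S)" if "x \<in> S" for x
      by (rule has_field_derivative_transform_within[of "D 0" _ x S 1]) (use D that in auto)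
  qed
qed

lemma smooth_on_continuous_on: "smooth_on S f \<Longrightarrow> continuous_on S f"
  by (metis DERIV_continuous_on smooth_on_derivative)

lemma smooth_on_UNIV_deriv:
  assumes "smooth_on UNIV f"
  shows "smooth_on UNIV (deriv f)" "(f has_real_derivative deriv f x) (at x)"
proof -
  from assms obtain g where g: "smooth_on UNIV g" "\<And>x. (f has_real_derivative g x) (at x)"
    by (metis UNIV_I smooth_on_derivative)
  then have "deriv f = g"
    by (auto intro: DERIV_imp_deriv)
  with g show "smooth_on UNIV (deriv f)" "(f has_real_derivative deriv f x) (at x)"
    by auto
qed

lemma smooth_on_subset: "smooth_on S f \<Longrightarrow> T \<subseteq> S \<Longrightarrow> smooth_on T f"
  unfolding smooth_on_def by (elim ex_forward) (auto 4 4 intro: has_field_derivative_subset)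

text \<open>
The functions built from smooth ones by sums and products. By the sum and product rules this class is
stable under differentiation, which gives closure of smoothness under both operations at once and
replaces the Leibniz formula for higher derivatives.
\<close>

inductive smooth_ring :: "real set \<Rightarrow> (real \<Rightarrow> real) \<Rightarrow> bool" for S
  where base: "smooth_on S f \<Longrightarrow> smooth_ring S f"
  | add: "smooth_ring S f \<Longrightarrow> smooth_ring S g \<Longrightarrow> smooth_ring S (\<lambda>x. f x + g x)"
  | mult: "smooth_ring S f \<Longrightarrow> smooth_ring S g \<Longrightarrow> smooth_ring S (\<lambda>x. f x * g x)"

lemma smooth_ring_imp_smooth_on:
  assumes "smooth_ring S f"
  shows "smooth_on S f"
proof (rule smooth_on_coinduct[where P = "smooth_ring S", OF assms])
  fix f
  assume "smooth_ring S f"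
  then show "\<exists>g. smooth_ring S g \<and> (\<forall>x\<in>S. (f has_real_derivative g x) (at x within S))"
  proof induction
    case (base f)
    then show ?case
      by (metis smooth_on_derivative smooth_ring.base)
  next
    case (add f g)
    then obtain f' g' where
      "smooth_ring S f'" "\<forall>x\<in>S. (f has_real_derivative f' x) (at x within S)"
      "smooth_ring S g'" "\<forall>x\<in>S. (g has_real_derivative g' x) (at x within S)"
      by blast
    then show ?case
      by (intro exI[of _ "\<lambda>x. f' x + g' x"] conjI smooth_ring.add ballI DERIV_add) auto
  next
    case (mult f g)
    then obtain f' g' where
      "smooth_ring S f'" "\<forall>x\<in>S. (f has_real_derivative f' x) (at x within S)"
      "smooth_ring S g'" "\<forall>x\<in>S. (g has_real_derivative g' x) (at x within S)"
      by blast
    then show ?case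
      using mult.hyps
      by (intro exI[of _ "\<lambda>x. f' x * g x + g' x * f x"] conjI smooth_ring.add smooth_ring.mult
          ballI DERIV_mult) auto
  qed
qed

lemma smooth_on_add: "smooth_on S f \<Longrightarrow> smooth_on S g \<Longrightarrow> smooth_on S (\<lambda>x. f x + g x)"
  and smooth_on_mult: "smooth_on S f \<Longrightarrow> smooth_on S g \<Longrightarrow> smooth_on S (\<lambda>x. f x * g x)"
  by (auto intro!: smooth_ring_imp_smooth_on intro: smooth_ring.intros)

lemma smooth_on_const: "smooth_on S (\<lambda>x. c)"
proof (rule smooth_on_coinduct[where P = "\<lambda>f. \<exists>c. f = (\<lambda>x. c)"])
  fix f :: "real \<Rightarrow> real" assume "\<exists>c. f = (\<lambda>x. c)"
  then show "\<exists>g. (\<exists>c. g = (\<lambda>x. c)) \<and> (\<forall>x\<in>S. (f has_real_derivative g x) (at x within S))"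
    by (intro exI[of _ "\<lambda>x. 0"]) auto
qed auto

lemma smooth_on_affine:
  assumes "smooth_on UNIV f"
  shows "smooth_on UNIV (\<lambda>x. f (a * x + b))"
proof -
  from assms obtain D where D: "\<forall>x. D 0 x = f x"
    "\<forall>n x. (D n has_real_derivative D (Suc n) x) (at x)"
    unfolding smooth_on_def by auto
  have "((\<lambda>x. a ^ n * D n (a * x + b)) has_real_derivative a ^ Suc n * D (Suc n) (a * x + b)) (at x)"
    for n x
  proof -
    have "((\<lambda>x. D n (a * x + b)) has_real_derivative D (Suc n) (a * x + b) * a) (at x)"
      by (rule DERIV_chain2[where f = "D n" and g = "\<lambda>x. a * x + b"])
         (use D in \<open>auto intro!: derivative_eq_intros\<close>)
    then show ?thesis
      by (auto intro!: derivative_eq_intros)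
  qed
  then show ?thesis
    unfolding smooth_on_def using D(1)
    by (intro exI[of _ "\<lambda>n x. a ^ n * D n (a * x + b)"]) auto
qed

text \<open>
With \<open>p = 1\<close> this is the classical smooth function that vanishes to infinite order at \<open>0\<close>. The
polynomial factor makes the family stable under differentiation.
\<close>

definition flat_fun :: "real poly \<Rightarrow> real \<Rightarrow> real"
  where "flat_fun p x = (if x > 0 then poly p (1 / x) * exp (- (1 / x)) else 0)"

text \<open>
Under \<open>y = 1 / h\<close> this covers the difference quotients of \<open>flat_fun\<close> at \<open>0\<close> from the right: division
by \<open>h\<close> only multiplies the polynomial by \<open>y\<close>.
\<close>

lemma poly_times_exp_minus_tendsto_0: "((\<lambda>y. poly p y * exp (- y)) \<longlongrightarrow> 0) at_top"
  for p :: "real poly"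
proof -
  have "((\<lambda>y. \<Sum>i\<le>degree p. coeff p i * (y ^ i / exp y)) \<longlongrightarrow> (\<Sum>i\<le>degree p. coeff p i * 0)) at_top"
    by (intro tendsto_intros tendsto_power_div_exp_0)
  then show ?thesis
    by (simp add: poly_altdef exp_minus divide_inverse sum_distrib_right mult.assoc)
qed

lemma flat_fun_has_derivative:
  "(flat_fun p has_real_derivative flat_fun ((p - pderiv p) * [:0, 0, 1:]) x) (at x)"
proof -
  consider "x < 0" | "x = 0" | "x > 0" by linarith
  then show ?thesis
  proof cases
    case 1
    have "(flat_fun p has_real_derivative 0) (at x)"
      by (rule has_field_derivative_transform_within_open[of "\<lambda>x. 0" _ _ "{..<0}"])
         (use 1 in \<open>auto simp: flat_fun_def\<close>)
    with 1 show ?thesis by (simp add: flat_fun_def)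
  next
    case 2
    have left: "((\<lambda>h. flat_fun p h / h) \<longlongrightarrow> 0) (at_left 0)"
      by (rule tendsto_eventually)
         (auto simp: flat_fun_def eventually_at_left_field intro!: exI[of _ "-1"])
    \<comment> \<open>The extra factor \<open>y\<close> is the denominator of the difference quotient, as \<open>y = 1 / h\<close>.\<close>
    have "((\<lambda>y. poly (p * [:0, 1:]) y * exp (- y)) \<longlongrightarrow> 0) at_top"
      by (rule poly_times_exp_minus_tendsto_0)
    then have "((\<lambda>h. poly (p * [:0, 1:]) (inverse h) * exp (- inverse h)) \<longlongrightarrow> 0) (at_right 0)"
      by (rule filterlim_compose[OF _ filterlim_inverse_at_top_right])
    moreover have "\<forall>\<^sub>F h in at_right 0. poly (p * [:0, 1:]) (inverse h) * exp (- inverse h) = flat_fun p h / h"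
      by (auto simp: flat_fun_def eventually_at_right_field field_simps intro!: exI[of _ 1])
    ultimately have right: "((\<lambda>h. flat_fun p h / h) \<longlongrightarrow> 0) (at_right 0)"
      by (rule Lim_transform_eventually)
    have "((\<lambda>h. flat_fun p h / h) \<longlongrightarrow> 0) (at 0)"
      using left right by (simp add: filterlim_at_split)
    then show ?thesis
      using 2 by (simp add: has_field_derivative_iff flat_fun_def)
  next
    case 3
    have "((\<lambda>x. poly p (1 / x) * exp (- (1 / x))) has_real_derivative
        flat_fun ((p - pderiv p) * [:0, 0, 1:]) x) (at x)"
      using 3 by (auto intro!: derivative_eq_intros simp: flat_fun_def field_simps power2_eq_square)
    then show ?thesis
      by (rule has_field_derivative_transform_within_open[of _ _ _ "{0<..}"])
         (use 3 in \<open>auto simp: flat_fun_def\<close>)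
  qed
qed

lemma smooth_on_flat_fun: "smooth_on UNIV (flat_fun p)"
proof (rule smooth_on_coinduct[where P = "\<lambda>f. \<exists>p. f = flat_fun p"])
  fix f assume "\<exists>p. f = flat_fun p"
  then show "\<exists>g. (\<exists>p. g = flat_fun p) \<and> (\<forall>x\<in>UNIV. (f has_real_derivative g x) (at x))"
    using flat_fun_has_derivative by blast
qed auto

lemma test_function_smooth: "test_function \<phi> \<Longrightarrow> smooth_on UNIV \<phi>"
  by (simp add: test_function_def)

text \<open>
A compact subset of the open interval lies in a smaller closed interval; having its endpoints at hand
is more convenient than the closure of the support.
\<close>

lemma test_function_iff:
  "test_function \<phi> \<longleftrightarrow> smooth_on UNIV \<phi> \<and>
    (\<exists>a b. 0 < a \<and> a < b \<and> b < 1 \<and> (\<forall>x. x \<notin> {a..b} \<longrightarrow> \<phi> x = 0))"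
proof -
  have "\<exists>a b. 0 < a \<and> a < b \<and> b < 1 \<and> (\<forall>x. x \<notin> {a..b} \<longrightarrow> \<phi> x = 0)"
    if "closure {x. \<phi> x \<noteq> 0} \<subseteq> {0<..<1}"
  proof (cases "{x. \<phi> x \<noteq> 0} = {}")
    case True
    then show ?thesis by (intro exI[of _ "1/3"] exI[of _ "2/3"]) auto
  next
    case False
    let ?K = "closure {x. \<phi> x \<noteq> 0}"
    have "compact ?K"
      using bounded_subset[OF bounded_box that[folded box_real(1)]] by (simp add: compact_eq_bounded_closed)
    moreover have "?K \<noteq> {}" using False by simp
    ultimately have "\<exists>a\<in>?K. \<forall>x\<in>?K. a \<le> x" and "\<exists>b\<in>?K. \<forall>x\<in>?K. x \<le> b"
      using compact_attains_inf[of ?K] compact_attains_sup[of ?K] by simp_all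
    then obtain a b where ab: "a \<in> ?K" "b \<in> ?K" "\<forall>x\<in>?K. a \<le> x" "\<forall>x\<in>?K. x \<le> b"
      by (elim bexE) (rule that)
    have "a \<in> {0<..<1}" "b \<in> {0<..<1}" "a \<le> b"
      using ab \<open>?K \<subseteq> {0<..<1}\<close> by blast+
    then have "0 < a" "b < 1" "a \<le> b" by simp_all
    moreover have "\<phi> x = 0" if "x \<notin> {a..(b + 1) / 2}" for x
    proof (rule ccontr)
      assume "\<phi> x \<noteq> 0"
      then have "x \<in> ?K" using closure_subset[of "{x. \<phi> x \<noteq> 0}"] by auto
      then have "a \<le> x" "x \<le> b" using ab(3,4) by auto
      then show False using \<open>b < 1\<close> \<open>x \<notin> {a..(b + 1) / 2}\<close> by simp
    qed
    ultimately show ?thesis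
      by (intro exI[of _ a] exI[of _ "(b + 1) / 2"]) simp
  qed
  moreover have "closure {x. \<phi> x \<noteq> 0} \<subseteq> {0<..<1}"
    if "0 < a" "a < b" "b < 1" "\<forall>x. x \<notin> {a..b} \<longrightarrow> \<phi> x = 0" for a b
  proof -
    have "closure {x. \<phi> x \<noteq> 0} \<subseteq> {a..b}"
      by (rule closure_minimal) (use that in auto)
    then show ?thesis using that by auto
  qed
  ultimately show ?thesis unfolding test_function_def by blast
qed

lemma test_function_continuous: "test_function \<phi> \<Longrightarrow> continuous_on S \<phi>"
  using smooth_on_continuous_on continuous_on_subset test_function_smooth by blast

lemma test_function_deriv:
  assumes "test_function \<phi>"
  shows "test_function (deriv \<phi>)"
proof -
  from assms obtain a b where ab: "0 < a" "a < b" "b < 1" "\<And>x. x \<notin> {a..b} \<Longrightarrow> \<phi> x = 0"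
    unfolding test_function_iff by blast
  have "deriv \<phi> x = 0" if "x \<notin> {a..b}" for x
  proof -
    have "(\<phi> has_real_derivative 0) (at x)"
      by (rule has_field_derivative_transform_within_open[of "\<lambda>x. 0" _ _ "- {a..b}"])
         (use ab that in auto)
    then show ?thesis by (rule DERIV_imp_deriv)
  qed
  moreover have "smooth_on UNIV (deriv \<phi>)"
    using assms by (intro smooth_on_UNIV_deriv(1) test_function_smooth)
  ultimately show ?thesis
    unfolding test_function_iff using ab(1-3) by (intro conjI exI[of _ a] exI[of _ b]) simp_all
qed

lemma test_function_derivs: "test_function \<phi> \<Longrightarrow> test_function ((deriv ^^ l) \<phi>)"
  by (induction l) (auto intro: test_function_deriv)

lemma test_function_cmult: "test_function \<phi> \<Longrightarrow> test_function (\<lambda>x. c * \<phi> x)"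
  unfolding test_function_iff
  by (intro conjI smooth_on_mult smooth_on_const) (fastforce, auto 4 4)

lemma test_function_add:
  assumes "test_function \<phi>" "test_function \<psi>"
  shows "test_function (\<lambda>x. \<phi> x + \<psi> x)"
proof -
  have "closure {x. \<phi> x + \<psi> x \<noteq> 0} \<subseteq> closure ({x. \<phi> x \<noteq> 0} \<union> {x. \<psi> x \<noteq> 0})"
    by (rule closure_mono) auto
  with assms show ?thesis
    unfolding test_function_def closure_Un by (auto intro: smooth_on_add)
qed

text \<open>
A function that is smooth only on \<open>[0,1]\<close> acts on test functions by multiplication: the product can
be continued by zero, and all one-sided derivatives of the product vanish off the support.
\<close>

lemma test_function_smooth_mult:
  assumes "smooth_on {0..1} V" "test_function \<phi>"
  shows "\<exists>\<psi>. test_function \<psi> \<and> (\<forall>x\<in>{0..1}. \<psi> x = V x * \<phi> x)"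
proof -
  from assms(2) obtain a b where ab: "0 < a" "a < b" "b < 1" "\<And>x. x \<notin> {a..b} \<Longrightarrow> \<phi> x = 0"
    unfolding test_function_iff by blast
  have "smooth_on {0..1} (\<lambda>x. V x * \<phi> x)"
    using assms smooth_on_mult smooth_on_subset test_function_smooth by blast
  then obtain D where D: "\<forall>x\<in>{0..1}. D 0 x = V x * \<phi> x"
    "\<forall>n. \<forall>x\<in>{0..1}. (D n has_real_derivative D (Suc n) x) (at x within {0..1})"
    unfolding smooth_on_def by blast
  have 0: "D n x = 0" if "x \<in> {0..1}" "x \<notin> {a..b}" for n x
    using that
  proof (induction n arbitrary: x)
    case 0
    then show ?case using D(1) ab(4) by auto
  next
    case (Suc n)
    have "(D n has_real_derivative 0) (at x within {0..1})"
    proof -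
      have "open (- {a..b})" by auto
      then obtain d where d: "d > 0" "ball x d \<subseteq> - {a..b}"
        using Suc.prems by (meson ComplI openE)
      have "D n y = 0" if "y \<in> {0..1}" "dist y x < d" for y
        using Suc.IH[of y] d that by (auto simp: subset_eq dist_commute)
      then show ?thesis
        by (intro has_field_derivative_transform_within[OF DERIV_const d(1) Suc.prems(1)]) simp
    qed
    moreover have "(D n has_real_derivative D (Suc n) x) (at x within {0..1})"
      using D Suc by blast
    moreover have "at x within {0..1} \<noteq> bot"
      using Suc.prems(1) by (simp add: trivial_limit_within islimpt_Icc)
    ultimately show ?case
      by (metis has_field_derivative_unique)
  qed
  \<comment> \<open>the derivatives of the product, continued by zero\<close>
  define E where "E n x = (if x \<in> {a..b} then D n x else 0)" for n x
  have E: "(E n has_real_derivative E (Suc n) x) (at x)" for n x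
  proof (cases "x \<in> {a..b}")
    case True
    then have "(D n has_real_derivative D (Suc n) x) (at x within {0<..<1})"
      using D(2) ab by (intro DERIV_subset[where s = "{0..1}" and t = "{0<..<1}"]) auto
    then have "(D n has_real_derivative D (Suc n) x) (at x)"
      using True ab(1-3) at_within_open[of x "{0<..<1}"] by simp
    then have "(E n has_real_derivative D (Suc n) x) (at x)"
      by (rule has_field_derivative_transform_within_open[of _ _ _ "{0<..<1}"])
         (use ab True 0 in \<open>auto simp: E_def\<close>)
    with True show ?thesis by (simp add: E_def)
  next
    case False
    have "(E n has_real_derivative 0) (at x)"
      by (rule has_field_derivative_transform_within_open[of "\<lambda>x. 0" _ _ "- {a..b}"])
         (use False in \<open>auto simp: E_def\<close>)
    moreover have "E (Suc n) x = 0" using False by (simp only: E_def if_False)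
    ultimately show ?thesis by simp
  qed
  have "test_function (E 0)"
    unfolding test_function_iff
  proof (intro conjI)
    show "smooth_on UNIV (E 0)"
      unfolding smooth_on_def by (rule exI[of _ E]) (use E in auto)
    show "\<exists>a b. 0 < a \<and> a < b \<and> b < 1 \<and> (\<forall>x. x \<notin> {a..b} \<longrightarrow> E 0 x = 0)"
      using ab by (intro exI[of _ a] exI[of _ b]) (auto simp: E_def)
  qed
  moreover have "\<forall>x\<in>{0..1}. E 0 x = V x * \<phi> x"
    using D(1) 0[of _ 0] by (auto simp: E_def)
  ultimately show ?thesis by blast
qed

text \<open>
An antiderivative is constant on each side of the support, and a vanishing mean says that the two
constants agree.
\<close>

lemma test_function_antiderivative:
  assumes "test_function \<psi>" "integral {0..1} \<psi> = 0"
  shows "\<exists>\<phi>. test_function \<phi> \<and> deriv \<phi> = \<psi>"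
proof -
  from assms(1) obtain a b where ab: "0 < a" "a < b" "b < 1" "\<And>x. x \<notin> {a..b} \<Longrightarrow> \<psi> x = 0"
    unfolding test_function_iff by blast
  have cont: "isCont \<psi> x" for x
    using test_function_continuous[OF assms(1), of UNIV] by (simp add: continuous_on_eq_continuous_at)
  obtain F where "\<And>x. (F has_vector_derivative \<psi> x) (at x)"
    using einterval_antiderivative[of "-\<infinity>" \<infinity> \<psi>] cont by auto
  then have F: "(F has_real_derivative \<psi> x) (at x)" for x
    by (simp add: has_real_derivative_iff_has_vector_derivative)
  have F_const: "F x = F y" if "\<And>z. z \<in> {min x y..max x y} \<Longrightarrow> z \<notin> {a..b}" for x y
  proof -
    have *: "F x = F y" if "x < y" "\<And>z. z \<in> {x..y} \<Longrightarrow> z \<notin> {a..b}" for x y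
    proof (rule sym, rule DERIV_isconst2[of x y])
      show "continuous_on {x..y} F"
        using F by (meson DERIV_isCont continuous_at_imp_continuous_on)
      show "(F has_real_derivative 0) (at z)" if "x < z" "z < y" for z
        using F[of z] ab(4)[of z] \<open>\<And>z. z \<in> {x..y} \<Longrightarrow> z \<notin> {a..b}\<close>[of z] that by auto
    qed (use that in auto)
    show ?thesis
      using *[of x y] *[of y x] that by (cases x y rule: linorder_cases) auto
  qed
  have "(\<psi> has_integral F 1 - F 0) {0..1}"
    by (rule fundamental_theorem_of_calculus)
       (use F in \<open>auto simp flip: has_real_derivative_iff_has_vector_derivative
            intro: has_field_derivative_at_within\<close>)
  with assms(2) have F01: "F 1 = F 0" by (simp add: integral_unique)
  define \<phi> where "\<phi> x = F x - F 0" for x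
  have d: "(\<phi> has_real_derivative \<psi> x) (at x)" for x
    unfolding \<phi>_def by (auto intro!: derivative_eq_intros F)
  have "smooth_on UNIV \<phi>"
  \<comment> \<open>After one step the antiderivative enters the class of smooth functions.\<close>
  proof (rule smooth_on_coinduct[where P = "\<lambda>f. f = \<phi> \<or> smooth_on UNIV f"])
    fix f assume "f = \<phi> \<or> smooth_on UNIV f"
    then show "\<exists>g. (g = \<phi> \<or> smooth_on UNIV g) \<and> (\<forall>x\<in>UNIV. (f has_real_derivative g x) (at x))"
      using d assms test_function_smooth smooth_on_UNIV_deriv by blast
  qed simp
  moreover have "\<phi> x = 0" if "x \<notin> {a..b}" for x
  proof (cases "x < a")
    case True
    then have "F x = F 0" using ab by (intro F_const) auto
    then show ?thesis by (simp add: \<phi>_def)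
  next
    case False
    then have "F x = F 1" using ab that by (intro F_const) auto
    then show ?thesis by (simp add: \<phi>_def F01)
  qed
  ultimately have "test_function \<phi>" using ab unfolding test_function_iff by blast
  moreover have "deriv \<phi> = \<psi>" using d by (auto intro: DERIV_imp_deriv)
  ultimately show ?thesis by blast
qed

text \<open>
If \<open>e\<close> is the flat function \<open>exp (-1/x)\<close>, then \<open>e (n x)\<close> tends to the indicator of \<open>x > 0\<close>
boundedly; the product of two such functions, one for each end of the interval, does the rest. A
bounded pointwise limit is all that dominated convergence asks for.
\<close>

lemma test_functions_approximate_indicator:
  assumes "0 < a" "a < b" "b < 1"
  shows "\<exists>\<phi>. (\<forall>n::nat. test_function (\<phi> n)) \<and> (\<forall>n x. \<bar>\<phi> n x\<bar> \<le> 1) \<and>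
    (\<forall>x. (\<lambda>n. \<phi> n x) \<longlonglongrightarrow> indicat_real {a<..<b} x)"
proof (intro exI conjI allI)
  define e where "e = flat_fun 1"
  have e: "e x = (if x > 0 then exp (- (1 / x)) else 0)" for x
    by (simp add: e_def flat_fun_def)
  have e_bound: "0 \<le> e x \<and> e x \<le> 1" for x
    by (auto simp: e)
  define \<phi> where "\<phi> n x = e (real n * x + - (real n * a)) * e (- real n * x + real n * b)" for n x
  show "test_function (\<phi> n)" for n
    unfolding test_function_iff
  proof (intro conjI)
    show "smooth_on UNIV (\<phi> n)"
      unfolding \<phi>_def e_def by (intro smooth_on_mult smooth_on_affine smooth_on_flat_fun)
    have "\<phi> n x = 0" if "x \<notin> {a..b}" for x
    proof (cases "x < a")
      case True
      then have "real n * x + - (real n * a) \<le> 0" by (simp add: mult_left_mono)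
      then show ?thesis by (simp add: \<phi>_def e)
    next
      case False
      then have "- real n * x + real n * b \<le> 0" using that by (simp add: mult_left_mono)
      then show ?thesis by (simp add: \<phi>_def e)
    qed
    then show "\<exists>a b. 0 < a \<and> a < b \<and> b < 1 \<and> (\<forall>x. x \<notin> {a..b} \<longrightarrow> \<phi> n x = 0)"
      using assms by blast
  qed
  show "\<bar>\<phi> n x\<bar> \<le> 1" for n x
    using e_bound by (simp add: \<phi>_def abs_mult mult_le_one)
  have lim: "(\<lambda>n. e (real n * y)) \<longlonglongrightarrow> (if y > 0 then 1 else 0)" for y
  proof (cases "y > 0")
    case True
    have "(\<lambda>n. exp (- (1 / y * (1 / real n)))) \<longlonglongrightarrow> exp (- (1 / y * 0))"
      by (intro tendsto_intros lim_1_over_n)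
    moreover have "\<forall>\<^sub>F n in sequentially. exp (- (1 / y * (1 / real n))) = e (real n * y)"
      using eventually_gt_at_top[of 0] by eventually_elim (use True in \<open>auto simp: e field_simps\<close>)
    ultimately show ?thesis
      using True by (simp add: Lim_transform_eventually)
  next
    case False
    then have "e (real n * y) = 0" for n by (auto simp: e zero_less_mult_iff)
    with False show ?thesis by simp
  qed
  show "(\<lambda>n. \<phi> n x) \<longlonglongrightarrow> indicat_real {a<..<b} x" for x
  proof -
    have "(\<lambda>n. e (real n * (x - a)) * e (real n * (b - x))) \<longlonglongrightarrow>
      (if x - a > 0 then 1 else 0) * (if b - x > 0 then 1 else 0)"
      by (intro tendsto_mult lim)
    moreover have "(if x - a > 0 then 1 else 0) * (if b - x > 0 then 1 else 0) = indicat_real {a<..<b} x"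
      by (auto simp: indicator_def)
    ultimately show ?thesis by (simp add: \<phi>_def algebra_simps)
  qed
qed

section \<open>Square-integrable functions and the fundamental lemma\<close>

lemma leb01_AE_space: "(\<And>x. x \<in> {0..1} \<Longrightarrow> P x) \<Longrightarrow> AE x in leb01. P x"
  by (rule AE_I2) simp

lemma continuous_measurable_leb01: "continuous_on {0..1} f \<Longrightarrow> f \<in> borel_measurable leb01"
  by (rule continuous_imp_measurable_on_sets_lebesgue) auto

text \<open>
Completeness of Lebesgue measure gives measurability of \<open>g\<close> for free.
\<close>

lemma measurable_leb01_AE:
  fixes f g :: "real \<Rightarrow> complex"
  assumes f: "f \<in> borel_measurable leb01" and ae: "AE x in leb01. f x = g x"
  shows "g \<in> borel_measurable leb01"
proof -
  have "AE x in lebesgue. indicator {0..1} x *\<^sub>R f x = indicator {0..1} x *\<^sub>R g x"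
    using ae by (subst (asm) AE_restrict_space_iff) (auto elim!: eventually_mono simp: indicator_def)
  moreover have "(\<lambda>x. indicator {0..1} x *\<^sub>R f x) \<in> borel_measurable lebesgue"
    using f by (simp add: borel_measurable_restrict_space_iff)
  ultimately have "(\<lambda>x. indicator {0..1} x *\<^sub>R g x) \<in> borel_measurable lebesgue"
    by (rule borel_measurable_AE[rotated])
  then show ?thesis
    by (simp add: borel_measurable_restrict_space_iff)
qed

lemma indicator_measurable_leb01:
  assumes "S \<in> sets borel"
  shows "(\<lambda>x. complex_of_real (indicat_real S x)) \<in> borel_measurable leb01"
proof -
  have "(\<lambda>x. complex_of_real (indicat_real S x)) \<in> borel_measurable lborel"
    using assms by measurable
  then show ?thesis
    by (intro measurable_restrict_space1 measurable_completion)
qed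

lemma integral_const_leb01: "(LINT x|leb01. c) = c" for c :: "'a::{banach,second_countable_topology}"
  by (simp add: measure_restrict_space)

lemma L2_measurable: "f \<in> L2 \<Longrightarrow> f \<in> borel_measurable leb01"
  by (simp add: L2_def)

lemma L2_integrable_square: "f \<in> L2 \<Longrightarrow> integrable leb01 (\<lambda>x. (cmod (f x))\<^sup>2)"
  by (simp add: L2_def)

lemma L2_AE:
  assumes f: "f \<in> L2" and ae: "AE x in leb01. f x = g x"
  shows "g \<in> L2"
proof -
  have g: "g \<in> borel_measurable leb01"
    using measurable_leb01_AE[OF L2_measurable[OF f] ae] .
  moreover have "integrable leb01 (\<lambda>x. (cmod (g x))\<^sup>2)"
    by (rule integrable_cong_AE_imp[OF L2_integrable_square[OF f]])
       (use g ae in \<open>auto elim: eventually_mono\<close>)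
  ultimately show ?thesis by (simp add: L2_def)
qed

lemma L2_dominated:
  assumes "f \<in> borel_measurable leb01" "integrable leb01 h"
    and "\<And>x. x \<in> {0..1} \<Longrightarrow> (cmod (f x))\<^sup>2 \<le> h x"
  shows "f \<in> L2"
proof -
  have "integrable leb01 (\<lambda>x. (cmod (f x))\<^sup>2)"
    by (rule Bochner_Integration.integrable_bound[OF assms(2)])
       (use assms in \<open>force intro!: leb01_AE_space\<close>)+
  with assms(1) show ?thesis by (simp add: L2_def)
qed

lemma square_norm_add_le: "(cmod (a + b))\<^sup>2 \<le> 2 * (cmod a)\<^sup>2 + 2 * (cmod b)\<^sup>2"
proof -
  have "(cmod (a + b))\<^sup>2 \<le> (cmod a + cmod b)\<^sup>2"
    by (intro power_mono norm_triangle_ineq) simp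
  also have "\<dots> \<le> 2 * (cmod a)\<^sup>2 + 2 * (cmod b)\<^sup>2"
    using sum_squares_bound[of "cmod a" "cmod b"] by (simp add: power2_sum)
  finally show ?thesis .
qed

lemma L2_add: "f \<in> L2 \<Longrightarrow> g \<in> L2 \<Longrightarrow> (\<lambda>x. f x + g x) \<in> L2"
  by (rule L2_dominated[where h = "\<lambda>x. 2 * (cmod (f x))\<^sup>2 + 2 * (cmod (g x))\<^sup>2"])
     (auto simp: L2_def square_norm_add_le)

lemma L2_cmult: "f \<in> L2 \<Longrightarrow> (\<lambda>x. c * f x) \<in> L2"
  by (auto simp: L2_def norm_mult power_mult_distrib)

lemma bounded_on_unit_interval:
  fixes V :: "real \<Rightarrow> real"
  assumes "continuous_on {0..1} V"
  obtains M where "M \<ge> 0" "\<And>x. x \<in> {0..1} \<Longrightarrow> \<bar>V x\<bar> \<le> M"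
proof -
  have "bounded (V ` {0..1})"
    using assms by (intro compact_imp_bounded compact_continuous_image) auto
  then obtain M where "\<forall>x\<in>{0..1}. \<bar>V x\<bar> \<le> M"
    unfolding bounded_iff by auto
  then show thesis by (intro that[of "max M 0"]) force+
qed

lemma L2_mult_bounded:
  fixes V :: "real \<Rightarrow> real"
  assumes V: "continuous_on {0..1} V" and f: "f \<in> L2"
    and M: "\<And>x. x \<in> {0..1} \<Longrightarrow> \<bar>V x\<bar> \<le> M"
  shows "(\<lambda>x. of_real (V x) * f x) \<in> L2"
    "(LINT x|leb01. (cmod (of_real (V x) * f x))\<^sup>2) \<le> M\<^sup>2 * (LINT x|leb01. (cmod (f x))\<^sup>2)"
proof -
  have le: "(cmod (of_real (V x) * f x))\<^sup>2 \<le> M\<^sup>2 * (cmod (f x))\<^sup>2" if "x \<in> {0..1}" for x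
    using power_mono[OF M[OF that], of 2]
    by (simp add: norm_mult power_mult_distrib mult_right_mono)
  show L: "(\<lambda>x. of_real (V x) * f x) \<in> L2"
    by (rule L2_dominated[where h = "\<lambda>x. M\<^sup>2 * (cmod (f x))\<^sup>2"])
       (use f le L2_measurable[OF f] continuous_measurable_leb01[OF V] in \<open>auto simp: L2_def\<close>)
  have "(LINT x|leb01. (cmod (of_real (V x) * f x))\<^sup>2) \<le> (LINT x|leb01. M\<^sup>2 * (cmod (f x))\<^sup>2)"
    using L2_integrable_square[OF L] L2_integrable_square[OF f] le
    by (intro integral_mono) auto
  then show "(LINT x|leb01. (cmod (of_real (V x) * f x))\<^sup>2) \<le> M\<^sup>2 * (LINT x|leb01. (cmod (f x))\<^sup>2)"
    by simp
qed

lemma L2_integrable: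
  assumes "f \<in> L2"
  shows "integrable leb01 f"
proof (rule Bochner_Integration.integrable_bound)
  show "integrable leb01 (\<lambda>x. 1 + (cmod (f x))\<^sup>2)"
    using assms by (auto simp: L2_def)
  have "cmod z \<le> 1 + (cmod z)\<^sup>2" for z
    using sum_squares_bound[of 1 "cmod z"] norm_ge_zero[of z] unfolding power_one by linarith
  then show "AE x in leb01. cmod (f x) \<le> norm (1 + (cmod (f x))\<^sup>2)"
    by simp
qed (use assms in \<open>simp add: L2_def\<close>)

lemma integrable_mult_continuous:
  fixes f :: "real \<Rightarrow> complex" and \<phi> :: "real \<Rightarrow> real"
  assumes "integrable leb01 f" "continuous_on {0..1} \<phi>"
  shows "integrable leb01 (\<lambda>x. f x * of_real (\<phi> x))"
proof -
  obtain M where M: "\<And>x. x \<in> {0..1} \<Longrightarrow> \<bar>\<phi> x\<bar> \<le> M" "M \<ge> 0"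
    using bounded_on_unit_interval[OF assms(2)] by blast
  show ?thesis
  proof (rule Bochner_Integration.integrable_bound)
    show "integrable leb01 (\<lambda>x. M * cmod (f x))" using assms by auto
    show "AE x in leb01. cmod (f x * of_real (\<phi> x)) \<le> norm (M * cmod (f x))"
      using M by (intro leb01_AE_space) (auto simp: norm_mult mult_right_mono mult.commute)
    show "(\<lambda>x. f x * of_real (\<phi> x)) \<in> borel_measurable leb01"
      using assms continuous_measurable_leb01[OF assms(2)] by auto
  qed
qed

lemma integrable_mult_test_function:
  "f \<in> L2 \<Longrightarrow> test_function \<phi> \<Longrightarrow> integrable leb01 (\<lambda>x. f x * of_real (\<phi> x))"
  by (intro integrable_mult_continuous L2_integrable test_function_continuous)

text \<open>
Cauchy--Schwarz against the constant \<open>1\<close>: the variance of \<open>|f|\<close> is nonnegative.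
\<close>

lemma integral_square_norm_le:
  assumes "f \<in> L2"
  shows "(LINT x|leb01. cmod (f x))\<^sup>2 \<le> (LINT x|leb01. (cmod (f x))\<^sup>2)"
proof -
  define m where "m = (LINT x|leb01. cmod (f x))"
  have i: "integrable leb01 (\<lambda>x. cmod (f x))" "integrable leb01 (\<lambda>x. (cmod (f x))\<^sup>2)"
    using L2_integrable[OF assms] L2_integrable_square[OF assms] by auto
  have "0 \<le> (LINT x|leb01. (cmod (f x) - m)\<^sup>2)"
    by simp
  also have "\<dots> = (LINT x|leb01. (cmod (f x))\<^sup>2 + m\<^sup>2 - 2 * m * cmod (f x))"
    by (simp add: power2_diff mult_ac)
  also have "\<dots> = (LINT x|leb01. (cmod (f x))\<^sup>2) + m\<^sup>2 - 2 * m * m"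
    using i by (simp add: integral_const_leb01 m_def del: lebesgue_integral_const)
  finally show ?thesis by (simp add: m_def power2_eq_square)
qed

lemma integral_indicator_leb01:
  fixes h :: "real \<Rightarrow> complex"
  assumes h: "integrable leb01 h" and ab: "0 \<le> a" "a \<le> b" "b \<le> 1"
  shows "(LINT x|leb01. h x * of_real (indicat_real {a<..<b} x)) = integral {a..b} h"
    "(LINT x|leb01. h x * of_real (indicat_real {a..b} x)) = integral {a..b} h"
proof -
  have *: "(LINT x|leb01. h x * of_real (indicat_real S x)) = integral S h"
    if S: "S \<in> sets borel" "S \<subseteq> {0..1}" for S
  proof -
    have "integrable leb01 (\<lambda>x. h x * of_real (indicat_real S x))"
      by (rule Bochner_Integration.integrable_bound[OF h])
         (use h indicator_measurable_leb01[OF S(1)] in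
           \<open>auto simp: norm_mult intro!: borel_measurable_times mult_left_le AE_I2 indicator_le_1\<close>)
    then have "(LINT x|leb01. h x * of_real (indicat_real S x)) =
        integral {0..1} (\<lambda>x. h x * of_real (indicat_real S x))"
      by (intro lebesgue_integral_eq_integral) auto
    also have "\<dots> = integral {0..1} (\<lambda>x. if x \<in> S then h x else 0)"
      by (intro Henstock_Kurzweil_Integration.integral_cong) auto
    also have "\<dots> = integral ({0..1} \<inter> S) h"
      by (simp add: Henstock_Kurzweil_Integration.integral_restrict_Int Int_commute)
    also have "{0..1} \<inter> S = S" using S by auto
    finally show ?thesis .
  qed
  show "(LINT x|leb01. h x * of_real (indicat_real {a<..<b} x)) = integral {a..b} h"
    using *[of "{a<..<b}"] ab by (simp add: integral_open_interval_real greaterThanLessThan_subseteq_atLeastAtMost_iff)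
  show "(LINT x|leb01. h x * of_real (indicat_real {a..b} x)) = integral {a..b} h"
    using *[of "{a..b}"] ab by auto
qed

lemma AE_leb01_negligible:
  assumes "negligible N" "\<And>x. x \<in> {0<..<1} \<Longrightarrow> x \<notin> N \<Longrightarrow> P x"
  shows "AE x in leb01. P x"
proof -
  have "negligible (N \<union> {0, 1})" using assms(1) by (simp add: negligible_Un)
  then have "AE x in lebesgue. x \<notin> N \<union> {0, 1}"
    by (simp only: negligible_iff_null_sets AE_not_in)
  then have "AE x in lebesgue. x \<in> {0..1} \<longrightarrow> P x"
    by eventually_elim (use assms(2) in force)
  then show ?thesis by (subst AE_restrict_space_iff) auto
qed

text \<open>
By dominated convergence the integral of \<open>h\<close> over every subinterval vanishes, and almost every value
of \<open>h\<close> is a limit of averages over intervals by Lebesgue's differentiation theorem.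
\<close>

lemma fundamental_lemma:
  fixes h :: "real \<Rightarrow> complex"
  assumes h: "integrable leb01 h"
    and zero: "\<And>\<phi>. test_function \<phi> \<Longrightarrow> (LINT x|leb01. h x * of_real (\<phi> x)) = 0"
  shows "AE x in leb01. h x = 0"
proof -
  have int0: "integral {a..b} h = 0" if ab: "0 < a" "a < b" "b < 1" for a b
  proof -
    obtain \<phi> :: "nat \<Rightarrow> real \<Rightarrow> real" where \<phi>: "\<And>n. test_function (\<phi> n)" "\<And>n x. \<bar>\<phi> n x\<bar> \<le> 1"
      "\<And>x. (\<lambda>n. \<phi> n x) \<longlonglongrightarrow> indicat_real {a<..<b} x"
      using test_functions_approximate_indicator[OF ab] by blast
    have "(\<lambda>n. LINT x|leb01. h x * of_real (\<phi> n x)) \<longlonglongrightarrow>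
        (LINT x|leb01. h x * of_real (indicat_real {a<..<b} x))"
    proof (rule integral_dominated_convergence[where w = "\<lambda>x. cmod (h x)"])
      show "AE x in leb01. (\<lambda>n. h x * of_real (\<phi> n x)) \<longlonglongrightarrow> h x * of_real (indicat_real {a<..<b} x)"
        by (intro AE_I2 tendsto_intros \<phi>)
      show "AE x in leb01. cmod (h x * of_real (\<phi> n x)) \<le> cmod (h x)" for n
        using \<phi>(2) by (intro AE_I2) (simp add: norm_mult mult_left_le)
      show "(\<lambda>x. h x * of_real (\<phi> n x)) \<in> borel_measurable leb01" for n
        using integrable_mult_continuous[OF h test_function_continuous[OF \<phi>(1)]] by auto
      show "(\<lambda>x. h x * of_real (indicat_real {a<..<b} x)) \<in> borel_measurable leb01"
        using h by (intro borel_measurable_times indicator_measurable_leb01) auto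
    qed (use h in auto)
    then have "(LINT x|leb01. h x * of_real (indicat_real {a<..<b} x)) = 0"
      using zero[OF \<phi>(1)] by (simp add: LIMSEQ_const_iff)
    then show ?thesis using integral_indicator_leb01(1)[OF h, of a b] ab by simp
  qed
  define k where "k x = (if x \<in> {0..1} then h x else 0)" for x
  have "h integrable_on {0..1}"
    using has_integral_integral_lebesgue_on[OF h] by (auto simp: integrable_on_def)
  then have "k integrable_on UNIV"
    unfolding k_def by (simp only: integrable_restrict_UNIV)
  then have "k integrable_on cbox a b" for a b
    by (rule integrable_on_subcbox) simp
  then obtain N where N: "negligible N" "\<And>x e. \<lbrakk>x \<notin> N; 0 < e\<rbrakk> \<Longrightarrow>
      \<exists>d>0. \<forall>t. 0 < t \<and> t < d \<longrightarrow>
        norm (integral (cbox x (x + t *\<^sub>R One)) k /\<^sub>R t ^ DIM(real) - k x) < e"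
    by (rule integrable_ccontinuous_explicit[of k]) (rule that, assumption+)
  show ?thesis
  proof (rule AE_leb01_negligible[OF N(1)])
    fix x :: real assume x: "x \<in> {0<..<1}" "x \<notin> N"
    have "cmod (k x) < e" if e: "e > 0" for e
    proof -
      obtain d where d: "d > 0" "\<And>t. 0 < t \<Longrightarrow> t < d \<Longrightarrow>
          norm (integral (cbox x (x + t *\<^sub>R One)) k /\<^sub>R t ^ DIM(real) - k x) < e"
        using N(2)[OF x(2) e] by blast
      \<comment> \<open>small enough for the average to be close to the value and for the interval to stay inside \<open>(0,1)\<close>\<close>
      define t where "t = min (d / 2) ((1 - x) / 2)"
      have t: "0 < t" "t < d" "x + t < 1" using d(1) x by (auto simp: t_def min_def field_simps)
      have "integral {x..x + t} k = integral {x..x + t} h"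
        using x t by (intro Henstock_Kurzweil_Integration.integral_cong) (auto simp: k_def)
      also have "\<dots> = 0" using x t by (intro int0) auto
      finally show ?thesis using d(2)[OF t(1,2)] by simp
    qed
    then have "k x = 0" by (metis less_irrefl zero_less_norm_iff)
    then show "h x = 0" using x by (simp add: k_def)
  qed
qed

text \<open>
Fix a test function \<open>\<rho>\<close> with nonzero mean. Every test function becomes the derivative of a test
function after a multiple of \<open>\<rho>\<close> is subtracted, so \<open>h\<close> pairs with test functions as a constant does.
\<close>

lemma du_Bois_Reymond:
  fixes h :: "real \<Rightarrow> complex"
  assumes h: "integrable leb01 h"
    and zero: "\<And>\<phi>. test_function \<phi> \<Longrightarrow> (LINT x|leb01. h x * of_real (deriv \<phi> x)) = 0"
  shows "\<exists>c. AE x in leb01. h x = c"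
proof -
  have int_eq: "(LINT x|leb01. complex_of_real (\<phi> x)) = of_real (integral {0..1} \<phi>)"
    if "test_function \<phi>" for \<phi>
  proof -
    have "integrable leb01 (\<lambda>x. complex_of_real (\<phi> x))"
      using integrable_mult_continuous[of "\<lambda>x. 1" \<phi>] test_function_continuous[OF that] by auto
    then have "integrable leb01 \<phi>"
      using integrable_Re by fastforce
    then show ?thesis by (simp add: lebesgue_integral_eq_integral)
  qed
  \<comment> \<open>Otherwise the fundamental lemma would show that the constant \<open>1\<close> vanishes.\<close>
  obtain \<rho> where \<rho>: "test_function \<rho>" "integral {0..1} \<rho> \<noteq> 0"
  proof (rule ccontr)
    assume "\<not> thesis"
    then have "AE x in leb01. (1::complex) = 0"
      using that int_eq by (intro fundamental_lemma) auto
    then have "ae_filter leb01 = bot" by (simp add: trivial_limit_def)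
    then have "emeasure leb01 (space leb01) = 0" by (simp only: ae_filter_eq_bot_iff)
    then show False by (simp add: emeasure_restrict_space)
  qed
  define c where "c = (LINT x|leb01. h x * of_real (\<rho> x)) / of_real (integral {0..1} \<rho>)"
  have "AE x in leb01. h x - c = 0"
  proof (rule fundamental_lemma)
    show "integrable leb01 (\<lambda>x. h x - c)" using h by auto
    fix \<psi> assume \<psi>: "test_function \<psi>"
    define s where "s = integral {0..1} \<psi> / integral {0..1} \<rho>"
    have cont: "continuous_on {0..1} \<psi>" "continuous_on {0..1} \<rho>"
      using \<psi> \<rho> test_function_continuous by auto
    have "test_function (\<lambda>x. \<psi> x + - s * \<rho> x)"
      by (intro test_function_add test_function_cmult \<psi> \<rho>)
    moreover have "integral {0..1} (\<lambda>x. \<psi> x + - s * \<rho> x) = integral {0..1} \<psi> + - s * integral {0..1} \<rho>"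
      using cont by (subst Henstock_Kurzweil_Integration.integral_add)
        (auto intro!: integrable_continuous_interval continuous_intros)
    moreover have "\<dots> = 0" using \<rho>(2) by (simp add: s_def)
    ultimately obtain \<phi> where \<phi>: "test_function \<phi>" "deriv \<phi> = (\<lambda>x. \<psi> x + - s * \<rho> x)"
      using test_function_antiderivative[of "\<lambda>x. \<psi> x + - s * \<rho> x"] by auto
    have i: "integrable leb01 (\<lambda>x. h x * of_real (\<psi> x))" "integrable leb01 (\<lambda>x. h x * of_real (\<rho> x))"
      "integrable leb01 (\<lambda>x. c * complex_of_real (\<psi> x))"
      using integrable_mult_continuous[OF h] integrable_mult_continuous[of "\<lambda>x. c"] cont by auto
    have "0 = (LINT x|leb01. h x * of_real (\<psi> x) - of_real s * (h x * of_real (\<rho> x)))"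
      using zero[OF \<phi>(1)] by (simp add: \<phi>(2) algebra_simps)
    also have "\<dots> = (LINT x|leb01. h x * of_real (\<psi> x)) - of_real s * (LINT x|leb01. h x * of_real (\<rho> x))"
      using i by simp
    finally have "(LINT x|leb01. h x * of_real (\<psi> x)) = c * (LINT x|leb01. complex_of_real (\<psi> x))"
      unfolding int_eq[OF \<psi>] using \<rho>(2) by (simp add: s_def c_def field_simps)
    then show "(LINT x|leb01. (h x - c) * of_real (\<psi> x)) = 0"
      using i by (simp add: left_diff_distrib)
  qed
  then show ?thesis by (intro exI[of _ c]) simp
qed

section \<open>Weak derivatives and Sobolev spaces\<close>

lemma weak_deriv_unique:
  assumes "weak_deriv l f g" "weak_deriv l f h" "g \<in> L2" "h \<in> L2"
  shows "AE x in leb01. g x = h x"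
proof -
  have "AE x in leb01. g x - h x = 0"
  proof (rule fundamental_lemma)
    show "integrable leb01 (\<lambda>x. g x - h x)"
      using assms by (intro Bochner_Integration.integrable_diff L2_integrable)
    fix \<phi> assume \<phi>: "test_function \<phi>"
    have "(-1) ^ l * (LINT x|leb01. g x * of_real (\<phi> x)) = (-1) ^ l * (LINT x|leb01. h x * of_real (\<phi> x))"
      using assms(1)[unfolded weak_deriv_def, rule_format, OF \<phi>]
        assms(2)[unfolded weak_deriv_def, rule_format, OF \<phi>] by (rule trans[OF sym])
    then show "(LINT x|leb01. (g x - h x) * of_real (\<phi> x)) = 0"
      using integrable_mult_test_function[OF _ \<phi>] assms by (simp add: left_diff_distrib)
  qed
  then show ?thesis by simp
qed

lemma integral_mult_test_cong:
  assumes "f \<in> L2" "AE x in leb01. f x = f' x" "test_function \<phi>"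
  shows "(LINT x|leb01. f x * of_real (\<phi> x)) = (LINT x|leb01. f' x * of_real (\<phi> x))"
  using assms integrable_mult_test_function[OF assms(1,3)]
    integrable_mult_test_function[OF L2_AE[OF assms(1,2)] assms(3)]
  by (intro integral_cong_AE) (auto elim: eventually_mono)

lemma weak_deriv_cong:
  assumes "f \<in> L2" "AE x in leb01. f x = f' x"
  shows "weak_deriv l f g \<longleftrightarrow> weak_deriv l f' g"
  unfolding weak_deriv_def
  by (simp cong: imp_cong add: integral_mult_test_cong[OF assms test_function_derivs])

lemma weak_deriv_add:
  assumes "weak_deriv l f g" "weak_deriv l f' g'" "f \<in> L2" "f' \<in> L2" "g \<in> L2" "g' \<in> L2"
  shows "weak_deriv l (\<lambda>x. f x + f' x) (\<lambda>x. g x + g' x)"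
  unfolding weak_deriv_def
proof (intro allI impI)
  fix \<phi> assume \<phi>: "test_function \<phi>"
  note i = integrable_mult_test_function[OF _ test_function_derivs[OF \<phi>], of _ l]
    integrable_mult_test_function[OF _ \<phi>]
  show "(LINT x|leb01. (f x + f' x) * of_real ((deriv ^^ l) \<phi> x)) =
      (-1) ^ l * (LINT x|leb01. (g x + g' x) * of_real (\<phi> x))"
    using assms(1,2) \<phi> i[OF assms(3)] i[OF assms(4)] i[OF assms(5)] i[OF assms(6)]
    by (simp add: weak_deriv_def distrib_left distrib_right)
qed

lemma weak_deriv_cmult:
  assumes "weak_deriv l f g"
  shows "weak_deriv l (\<lambda>x. c * f x) (\<lambda>x. c * g x)"
  using assms by (simp add: weak_deriv_def mult.assoc mult.left_commute[of _ c])

lemma weak_deriv_zero: "weak_deriv 0 f f"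
  by (simp add: weak_deriv_def)

lemma weak_deriv_trans:
  assumes "weak_deriv l f g" "weak_deriv m g h"
  shows "weak_deriv (l + m) f h"
  using assms test_function_derivs
  by (simp add: weak_deriv_def funpow_add power_add)

text \<open>
If \<open>g\<close> is the derivative of order \<open>l\<close> of \<open>f\<close>, the higher derivatives of \<open>f\<close> are derivatives of \<open>g\<close>,
because the derivatives of test functions are test functions.
\<close>

lemma weak_deriv_cancel:
  assumes "weak_deriv l f g" "weak_deriv (l + m) f h"
  shows "weak_deriv m g h"
  unfolding weak_deriv_def
proof (intro allI impI)
  fix \<phi> assume \<phi>: "test_function \<phi>"
  have "(-1) ^ l * (LINT x|leb01. g x * of_real ((deriv ^^ m) \<phi> x)) =
      (LINT x|leb01. f x * of_real ((deriv ^^ (l + m)) \<phi> x))"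
    using assms(1) test_function_derivs[OF \<phi>] by (simp add: weak_deriv_def funpow_add)
  also have "\<dots> = (-1) ^ l * ((-1) ^ m * (LINT x|leb01. h x * of_real (\<phi> x)))"
    using assms(2) \<phi> by (simp add: weak_deriv_def power_add)
  finally show "(LINT x|leb01. g x * of_real ((deriv ^^ m) \<phi> x)) =
      (-1) ^ m * (LINT x|leb01. h x * of_real (\<phi> x))"
    by simp
qed

lemma L2_mult_smooth: "smooth_on {0..1} V \<Longrightarrow> f \<in> L2 \<Longrightarrow> (\<lambda>x. of_real (V x) * f x) \<in> L2"
  using bounded_on_unit_interval L2_mult_bounded(1) smooth_on_continuous_on by metis

text \<open>
The product rule is moved to the test function: \<open>V \<phi>' = (V \<phi>)' - V' \<phi>\<close>, and \<open>V \<phi>\<close> is again a test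
function.
\<close>

lemma weak_deriv_mult_smooth:
  assumes V: "smooth_on {0..1} V" "smooth_on {0..1} W"
    and VW: "\<And>x. x \<in> {0..1} \<Longrightarrow> (V has_real_derivative W x) (at x within {0..1})"
    and f: "f \<in> L2" and g: "g \<in> L2" and fg: "weak_deriv 1 f g"
  shows "weak_deriv 1 (\<lambda>x. of_real (V x) * f x) (\<lambda>x. of_real (W x) * f x + of_real (V x) * g x)"
  unfolding weak_deriv_def
proof (intro allI impI)
  fix \<phi> assume \<phi>: "test_function \<phi>"
  obtain \<psi> where \<psi>: "test_function \<psi>" "\<And>x. x \<in> {0..1} \<Longrightarrow> \<psi> x = V x * \<phi> x"
    using test_function_smooth_mult[OF V(1) \<phi>] by blast
  have d: "deriv \<psi> x = W x * \<phi> x + V x * deriv \<phi> x" if x: "x \<in> {0<..<1}" for x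
  proof -
    have "(V has_real_derivative W x) (at x within {0<..<1})"
      using x by (intro DERIV_subset[OF VW]) auto
    then have "(V has_real_derivative W x) (at x)"
      using x at_within_open[of x "{0<..<1}"] by simp
    then have "((\<lambda>x. V x * \<phi> x) has_real_derivative W x * \<phi> x + deriv \<phi> x * V x) (at x)"
      using smooth_on_UNIV_deriv(2)[OF test_function_smooth[OF \<phi>]] by (rule DERIV_mult)
    then have "(\<psi> has_real_derivative W x * \<phi> x + deriv \<phi> x * V x) (at x)"
      by (rule has_field_derivative_transform_within_open[of _ _ _ "{0<..<1}"])
         (use x \<psi>(2) in auto)
    then show ?thesis by (simp add: DERIV_imp_deriv mult.commute)
  qed
  have Wf: "(\<lambda>x. of_real (W x) * f x) \<in> L2" and Vf: "(\<lambda>x. of_real (V x) * f x) \<in> L2"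
    and Vg: "(\<lambda>x. of_real (V x) * g x) \<in> L2"
    using V f g by (auto intro: L2_mult_smooth)
  note \<phi>' = test_function_deriv[OF \<phi>] and \<psi>' = test_function_deriv[OF \<psi>(1)]
  note i = integrable_mult_test_function
  have "(LINT x|leb01. of_real (V x) * f x * of_real (deriv \<phi> x)) =
      (LINT x|leb01. f x * of_real (deriv \<psi> x) - of_real (W x) * f x * of_real (\<phi> x))"
  proof (rule integral_cong_AE)
    show "AE x in leb01. of_real (V x) * f x * of_real (deriv \<phi> x) =
        f x * of_real (deriv \<psi> x) - of_real (W x) * f x * of_real (\<phi> x)"
      by (rule AE_leb01_negligible[of "{}"]) (simp_all add: d algebra_simps)
  qed (use i[OF Vf \<phi>'] i[OF f \<psi>'] i[OF Wf \<phi>] in auto)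
  also have "\<dots> = (LINT x|leb01. f x * of_real (deriv \<psi> x)) -
      (LINT x|leb01. of_real (W x) * f x * of_real (\<phi> x))"
    using i[OF f \<psi>'] i[OF Wf \<phi>] by simp
  also have "(LINT x|leb01. f x * of_real (deriv \<psi> x)) = - (LINT x|leb01. g x * of_real (\<psi> x))"
    using fg \<psi>(1) by (simp add: weak_deriv_def)
  also have "(LINT x|leb01. g x * of_real (\<psi> x)) = (LINT x|leb01. of_real (V x) * g x * of_real (\<phi> x))"
    by (intro Bochner_Integration.integral_cong) (auto simp: \<psi>(2))
  finally show "(LINT x|leb01. of_real (V x) * f x * of_real ((deriv ^^ 1) \<phi> x)) =
      (-1) ^ 1 * (LINT x|leb01. (of_real (W x) * f x + of_real (V x) * g x) * of_real (\<phi> x))"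
    using i[OF Wf \<phi>] i[OF Vg \<phi>] by (simp add: distrib_right)
qed

lemma sobolev_L2: "f \<in> sobolev m \<Longrightarrow> f \<in> L2"
  by (simp add: sobolev_def)

lemma sobolev_mono: "f \<in> sobolev m \<Longrightarrow> n \<le> m \<Longrightarrow> f \<in> sobolev n"
  by (auto simp: sobolev_def)

lemma sobolev_0: "sobolev 0 = L2"
  using weak_deriv_zero by (auto simp: sobolev_def)

lemma wderiv_sobolev:
  assumes "f \<in> sobolev m" "l \<le> m"
  shows "wderiv l f \<in> L2" "weak_deriv l f (wderiv l f)"
proof -
  have "\<exists>g. g \<in> L2 \<and> weak_deriv l f g"
    using assms by (auto simp: sobolev_def)
  from someI_ex[OF this] show "wderiv l f \<in> L2" "weak_deriv l f (wderiv l f)"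
    by (auto simp: wderiv_def)
qed

lemma wderiv_AE:
  assumes "weak_deriv l f g" "g \<in> L2"
  shows "AE x in leb01. wderiv l f x = g x"
proof -
  from someI[of "\<lambda>g. g \<in> L2 \<and> weak_deriv l f g" g] assms
  have "wderiv l f \<in> L2" "weak_deriv l f (wderiv l f)"
    by (auto simp: wderiv_def)
  with assms show ?thesis by (intro weak_deriv_unique)
qed

lemma wderiv_cong:
  assumes "f \<in> L2" "AE x in leb01. f x = f' x"
  shows "wderiv l f = wderiv l f'"
  unfolding wderiv_def weak_deriv_cong[OF assms] ..

lemma sobolev_SucI:
  assumes "f \<in> L2" "weak_deriv 1 f g" "g \<in> sobolev m"
  shows "f \<in> sobolev (Suc m)"
  unfolding sobolev_def
proof (intro CollectI conjI allI impI)
  fix l assume "l \<le> Suc m"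
  show "\<exists>g\<in>L2. weak_deriv l f g"
  proof (cases l)
    case 0
    then show ?thesis using assms(1) weak_deriv_zero by blast
  next
    case (Suc j)
    with \<open>l \<le> Suc m\<close> have "j \<le> m" by simp
    then have "wderiv j g \<in> L2" "weak_deriv (1 + j) f (wderiv j g)"
      using wderiv_sobolev[OF assms(3)] weak_deriv_trans[OF assms(2)] by blast+
    then show ?thesis using Suc by auto
  qed
qed (use assms in auto)

lemma sobolev_add:
  assumes "f \<in> sobolev m" "g \<in> sobolev m"
  shows "(\<lambda>x. f x + g x) \<in> sobolev m"
  unfolding sobolev_def
proof (intro CollectI conjI allI impI)
  show "\<exists>h\<in>L2. weak_deriv l (\<lambda>x. f x + g x) h" if "l \<le> m" for l
    using wderiv_sobolev[OF assms(1) that] wderiv_sobolev[OF assms(2) that] assms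
    by (intro bexI[of _ "\<lambda>x. wderiv l f x + wderiv l g x"] weak_deriv_add L2_add)
       (simp_all add: sobolev_L2)
  show "(\<lambda>x. f x + g x) \<in> L2"
    using assms by (intro L2_add sobolev_L2)
qed

lemma sobolev_cmult:
  assumes "f \<in> sobolev m"
  shows "(\<lambda>x. c * f x) \<in> sobolev m"
  unfolding sobolev_def
proof (intro CollectI conjI allI impI)
  show "\<exists>h\<in>L2. weak_deriv l (\<lambda>x. c * f x) h" if "l \<le> m" for l
    using wderiv_sobolev[OF assms that]
    by (intro bexI[of _ "\<lambda>x. c * wderiv l f x"] weak_deriv_cmult L2_cmult)
  show "(\<lambda>x. c * f x) \<in> L2"
    by (rule L2_cmult[OF sobolev_L2[OF assms]])
qed

lemma wderiv_add:
  assumes "f \<in> sobolev m" "g \<in> sobolev m" "l \<le> m"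
  shows "AE x in leb01. wderiv l (\<lambda>x. f x + g x) x = wderiv l f x + wderiv l g x"
  using wderiv_sobolev[OF assms(1,3)] wderiv_sobolev[OF assms(2,3)] assms(1,2)
  by (intro wderiv_AE weak_deriv_add L2_add) (auto intro: sobolev_L2)

lemma wderiv_cmult:
  assumes "f \<in> sobolev m" "l \<le> m"
  shows "AE x in leb01. wderiv l (\<lambda>x. c * f x) x = c * wderiv l f x"
  using wderiv_sobolev[OF assms] by (intro wderiv_AE weak_deriv_cmult L2_cmult)

lemma wderiv_wderiv:
  assumes "weak_deriv l f g" "f \<in> sobolev (l + m)" "j \<le> m"
  shows "AE x in leb01. wderiv j g x = wderiv (l + j) f x"
  using wderiv_sobolev[OF assms(2), of "l + j"] assms(3)
  by (intro wderiv_AE weak_deriv_cancel[OF assms(1)]) auto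

lemma sobolev_derivative:
  assumes "weak_deriv l f g" "g \<in> L2" "f \<in> sobolev (l + m)"
  shows "g \<in> sobolev m"
  unfolding sobolev_def
proof (intro CollectI conjI allI impI)
  show "\<exists>h\<in>L2. weak_deriv j g h" if "j \<le> m" for j
    using wderiv_sobolev[OF assms(3), of "l + j"] that weak_deriv_cancel[OF assms(1)] by auto
qed fact

definition L2_sq :: "(real \<Rightarrow> complex) \<Rightarrow> real"
  where "L2_sq f = (LINT x|leb01. (cmod (f x))\<^sup>2)"

text \<open>
The square of \<open>sobolev_norm\<close>. Constants do not matter for convergence, so the crude inequality
\<open>|a + b|\<^sup>2 \<le> 2 |a|\<^sup>2 + 2 |b|\<^sup>2\<close> can replace Minkowski's inequality throughout.
\<close>

definition sobolev_sq :: "nat \<Rightarrow> (real \<Rightarrow> complex) \<Rightarrow> real"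
  where "sobolev_sq m f = (\<Sum>l\<le>m. L2_sq (wderiv l f))"

lemma sobolev_norm_eq_sqrt: "sobolev_norm m f = sqrt (sobolev_sq m f)"
  by (simp add: sobolev_norm_def sobolev_sq_def L2_sq_def)

lemma L2_sq_nonneg: "0 \<le> L2_sq f"
  by (simp add: L2_sq_def)

lemma sobolev_sq_nonneg: "0 \<le> sobolev_sq m f"
  by (simp add: sobolev_sq_def sum_nonneg L2_sq_nonneg)

lemma L2_sq_cong:
  assumes "f \<in> L2" "AE x in leb01. f x = g x"
  shows "L2_sq f = L2_sq g"
  unfolding L2_sq_def
  using assms L2_integrable_square[OF assms(1)] L2_integrable_square[OF L2_AE[OF assms]]
  by (intro integral_cong_AE) (auto elim: eventually_mono)

lemma L2_sq_add_le:
  assumes "f \<in> L2" "g \<in> L2"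
  shows "L2_sq (\<lambda>x. f x + g x) \<le> 2 * L2_sq f + 2 * L2_sq g"
proof -
  note i = assms[THEN L2_integrable_square]
  have "L2_sq (\<lambda>x. f x + g x) \<le> (LINT x|leb01. 2 * (cmod (f x))\<^sup>2 + 2 * (cmod (g x))\<^sup>2)"
    unfolding L2_sq_def using i L2_integrable_square[OF L2_add[OF assms]]
    by (intro integral_mono) (auto simp: square_norm_add_le)
  also have "\<dots> = 2 * L2_sq f + 2 * L2_sq g"
    using i by (simp add: L2_sq_def)
  finally show ?thesis .
qed

lemma sobolev_sq_cong:
  assumes "f \<in> L2" "AE x in leb01. f x = g x"
  shows "sobolev_sq m f = sobolev_sq m g"
  using wderiv_cong[OF assms] by (simp add: sobolev_sq_def)

lemma sobolev_sq_mono: "n \<le> m \<Longrightarrow> sobolev_sq n f \<le> sobolev_sq m f"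
  unfolding sobolev_sq_def by (intro sum_mono2) (auto simp: L2_sq_nonneg)

lemma sobolev_sq_add_le:
  assumes "f \<in> sobolev m" "g \<in> sobolev m"
  shows "sobolev_sq m (\<lambda>x. f x + g x) \<le> 2 * sobolev_sq m f + 2 * sobolev_sq m g"
proof -
  have "L2_sq (wderiv l (\<lambda>x. f x + g x)) \<le> 2 * L2_sq (wderiv l f) + 2 * L2_sq (wderiv l g)"
    if "l \<le> m" for l
    using L2_sq_add_le[of "wderiv l f" "wderiv l g"] wderiv_add[OF assms that]
      wderiv_sobolev(1)[OF assms(1) that] wderiv_sobolev(1)[OF assms(2) that]
      wderiv_sobolev(1)[OF sobolev_add[OF assms] that]
    by (simp add: L2_sq_cong)
  then show ?thesis
    by (auto simp: sobolev_sq_def sum_distrib_left simp flip: sum.distrib intro!: sum_mono)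
qed

lemma sobolev_sq_cmult:
  assumes "f \<in> sobolev m"
  shows "sobolev_sq m (\<lambda>x. c * f x) = (cmod c)\<^sup>2 * sobolev_sq m f"
proof -
  have "L2_sq (wderiv l (\<lambda>x. c * f x)) = (cmod c)\<^sup>2 * L2_sq (wderiv l f)" if "l \<le> m" for l
    using L2_sq_cong[OF _ wderiv_cmult[OF assms that]] wderiv_sobolev(1)[OF sobolev_cmult[OF assms] that]
    by (simp add: L2_sq_def norm_mult power_mult_distrib)
  then show ?thesis by (simp add: sobolev_sq_def sum_distrib_left)
qed

lemma sobolev_sq_derivative:
  assumes "weak_deriv l f g" "f \<in> sobolev (l + m)"
  shows "sobolev_sq m g = (\<Sum>j\<le>m. L2_sq (wderiv (l + j) f))"
  unfolding sobolev_sq_def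
proof (rule sum.cong[OF refl])
  fix j assume "j \<in> {..m}"
  then show "L2_sq (wderiv j g) = L2_sq (wderiv (l + j) f)"
    using wderiv_wderiv[OF assms, of j] wderiv_sobolev(1)[OF assms(2), of "l + j"]
    by (intro L2_sq_cong[symmetric]) (auto elim: eventually_mono)
qed

lemma sobolev_sq_derivative_le:
  assumes "weak_deriv l f g" "f \<in> sobolev (l + m)"
  shows "sobolev_sq m g \<le> sobolev_sq (l + m) f"
proof -
  have "(\<Sum>j\<le>m. L2_sq (wderiv (l + j) f)) = sum (\<lambda>j. L2_sq (wderiv j f)) ((+) l ` {..m})"
    by (subst sum.reindex) auto
  also have "\<dots> \<le> sobolev_sq (l + m) f"
    unfolding sobolev_sq_def by (intro sum_mono2) (auto simp: L2_sq_nonneg)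
  finally show ?thesis using sobolev_sq_derivative[OF assms] by simp
qed

lemma sobolev_sq_0: "f \<in> L2 \<Longrightarrow> sobolev_sq 0 f = L2_sq f"
  using L2_sq_cong[of f "wderiv 0 f"] wderiv_AE[OF weak_deriv_zero, of f]
  by (simp add: sobolev_sq_def eq_commute)

lemma sobolev_sq_Suc:
  assumes "weak_deriv 1 f g" "f \<in> sobolev (Suc m)"
  shows "sobolev_sq (Suc m) f = L2_sq f + sobolev_sq m g"
proof -
  have "sobolev_sq (Suc m) f = L2_sq (wderiv 0 f) + (\<Sum>j\<le>m. L2_sq (wderiv (Suc j) f))"
    unfolding sobolev_sq_def by (rule sum.atMost_Suc_shift)
  then show ?thesis
    using sobolev_sq_derivative[of 1 f g m] sobolev_sq_0[OF sobolev_L2[OF assms(2)]] assms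
    by (simp add: sobolev_sq_def)
qed

text \<open>
Induction on \<open>m\<close> for all multipliers at once: the derivative of \<open>V f\<close> is \<open>V' f + V f'\<close>, where the
smooth multipliers \<open>V'\<close> and \<open>V\<close> act on functions of one order of regularity less.
\<close>

lemma sobolev_mult_smooth:
  assumes "smooth_on {0..1} V"
  shows "\<exists>C\<ge>0. \<forall>f\<in>sobolev m. (\<lambda>x. of_real (V x) * f x) \<in> sobolev m \<and>
    sobolev_sq m (\<lambda>x. of_real (V x) * f x) \<le> C * sobolev_sq m f"
  using assms
proof (induction m arbitrary: V)
  case 0
  obtain M where M: "\<And>x. x \<in> {0..1} \<Longrightarrow> \<bar>V x\<bar> \<le> M"
    using bounded_on_unit_interval[OF smooth_on_continuous_on[OF 0]] by blast
  note b = L2_mult_bounded[OF smooth_on_continuous_on[OF 0] _ M]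
  show ?case
    using b by (intro exI[of _ "M\<^sup>2"]) (auto simp: sobolev_0 sobolev_sq_0 L2_sq_def)
next
  case (Suc m)
  note V = Suc.prems
  obtain W where W: "smooth_on {0..1} W"
    "\<And>x. x \<in> {0..1} \<Longrightarrow> (V has_real_derivative W x) (at x within {0..1})"
    using smooth_on_derivative[OF V] by blast
  obtain M where M: "\<And>x. x \<in> {0..1} \<Longrightarrow> \<bar>V x\<bar> \<le> M"
    using bounded_on_unit_interval[OF smooth_on_continuous_on[OF V]] by blast
  obtain C where C: "C \<ge> 0" "\<And>f. f \<in> sobolev m \<Longrightarrow> (\<lambda>x. of_real (V x) * f x) \<in> sobolev m"
    "\<And>f. f \<in> sobolev m \<Longrightarrow> sobolev_sq m (\<lambda>x. of_real (V x) * f x) \<le> C * sobolev_sq m f"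
    using Suc.IH[OF V] by blast
  obtain C' where C': "C' \<ge> 0" "\<And>f. f \<in> sobolev m \<Longrightarrow> (\<lambda>x. of_real (W x) * f x) \<in> sobolev m"
    "\<And>f. f \<in> sobolev m \<Longrightarrow> sobolev_sq m (\<lambda>x. of_real (W x) * f x) \<le> C' * sobolev_sq m f"
    using Suc.IH[OF W(1)] by blast
  show ?case
  proof (intro exI[of _ "M\<^sup>2 + 2 * C' + 2 * C"] conjI ballI)
    show "0 \<le> M\<^sup>2 + 2 * C' + 2 * C" using C(1) C'(1) by simp
    fix f assume f: "f \<in> sobolev (Suc m)"
    define g where "g = wderiv 1 f"
    have g: "g \<in> L2" "weak_deriv 1 f g"
      using wderiv_sobolev[OF f, of 1] by (auto simp: g_def)
    have gm: "g \<in> sobolev m" using sobolev_derivative[OF g(2,1)] f by simp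
    have fm: "f \<in> sobolev m" using sobolev_mono[OF f] by simp
    note f2 = sobolev_L2[OF f]
    let ?Vf = "\<lambda>x. of_real (V x) * f x"
    let ?h = "\<lambda>x. of_real (W x) * f x + of_real (V x) * g x"
    have d: "weak_deriv 1 ?Vf ?h"
      by (rule weak_deriv_mult_smooth[OF V W f2 g])
    have h: "?h \<in> sobolev m"
      by (intro sobolev_add C(2) C'(2) fm gm)
    show Vf: "?Vf \<in> sobolev (Suc m)"
      by (rule sobolev_SucI[OF L2_mult_smooth[OF V f2] d h])
    have "sobolev_sq (Suc m) ?Vf = L2_sq ?Vf + sobolev_sq m ?h"
      by (rule sobolev_sq_Suc[OF d Vf])
    also have "L2_sq ?Vf \<le> M\<^sup>2 * L2_sq f"
      using L2_mult_bounded(2)[OF smooth_on_continuous_on[OF V] f2 M] by (simp add: L2_sq_def)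
    also have "sobolev_sq m ?h \<le> 2 * (C' * sobolev_sq m f) + 2 * (C * sobolev_sq m g)"
      using sobolev_sq_add_le[OF C'(2)[OF fm] C(2)[OF gm]] C(3)[OF gm] C'(3)[OF fm] by linarith
    also have "M\<^sup>2 * L2_sq f \<le> M\<^sup>2 * sobolev_sq (Suc m) f"
      using sobolev_sq_Suc[OF g(2) f] sobolev_sq_nonneg[of m g] by (intro mult_left_mono) auto
    also have "C' * sobolev_sq m f \<le> C' * sobolev_sq (Suc m) f"
      using C'(1) by (intro mult_left_mono sobolev_sq_mono) auto
    also have "C * sobolev_sq m g \<le> C * sobolev_sq (Suc m) f"
      using C(1) sobolev_sq_Suc[OF g(2) f] L2_sq_nonneg[of f] by (intro mult_left_mono) auto
    finally show "sobolev_sq (Suc m) ?Vf \<le> (M\<^sup>2 + 2 * C' + 2 * C) * sobolev_sq (Suc m) f"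
      by (simp add: algebra_simps)
  qed
qed

lemma schroedinger_op_bounded:
  assumes "smooth_on {0..1} V"
  shows "\<exists>C\<ge>0. \<forall>f\<in>sobolev (m + 2). schroedinger_op V f \<in> sobolev m \<and>
    sobolev_sq m (schroedinger_op V f) \<le> C * sobolev_sq (m + 2) f"
proof -
  obtain C where C: "C \<ge> 0" "\<And>f. f \<in> sobolev m \<Longrightarrow> (\<lambda>x. of_real (V x) * f x) \<in> sobolev m"
    "\<And>f. f \<in> sobolev m \<Longrightarrow> sobolev_sq m (\<lambda>x. of_real (V x) * f x) \<le> C * sobolev_sq m f"
    using sobolev_mult_smooth[OF assms] by blast
  show ?thesis
  proof (intro exI[of _ "2 + 2 * C"] conjI ballI)
    fix f assume f: "f \<in> sobolev (m + 2)"
    have w: "wderiv 2 f \<in> L2" "weak_deriv 2 f (wderiv 2 f)"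
      using wderiv_sobolev[OF f, of 2] by auto
    have f': "f \<in> sobolev (2 + m)" using f by (simp add: add.commute)
    have wm: "wderiv 2 f \<in> sobolev m" by (rule sobolev_derivative[OF w(2,1) f'])
    have fm: "f \<in> sobolev m" using sobolev_mono[OF f] by simp
    show "schroedinger_op V f \<in> sobolev m"
      unfolding schroedinger_op_def by (intro sobolev_add wm C(2) fm)
    have "sobolev_sq m (schroedinger_op V f) \<le>
        2 * sobolev_sq m (wderiv 2 f) + 2 * sobolev_sq m (\<lambda>x. of_real (V x) * f x)"
      unfolding schroedinger_op_def by (rule sobolev_sq_add_le[OF wm C(2)[OF fm]])
    also have "sobolev_sq m (wderiv 2 f) \<le> sobolev_sq (m + 2) f"
      using sobolev_sq_derivative_le[OF w(2) f'] by (simp add: add.commute)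
    also have "sobolev_sq m (\<lambda>x. of_real (V x) * f x) \<le> C * sobolev_sq m f"
      by (rule C(3)[OF fm])
    also have "C * sobolev_sq m f \<le> C * sobolev_sq (m + 2) f"
      using C(1) by (intro mult_left_mono sobolev_sq_mono) auto
    finally show "sobolev_sq m (schroedinger_op V f) \<le> (2 + 2 * C) * sobolev_sq (m + 2) f"
      by (simp add: algebra_simps)
  qed (use C(1) in simp)
qed

section \<open>Point values of functions with one weak derivative\<close>

definition primitive :: "(real \<Rightarrow> complex) \<Rightarrow> real \<Rightarrow> complex"
  where "primitive g x = integral {0..x} g"

lemma integrable_on_subinterval_leb01:
  fixes g :: "real \<Rightarrow> complex"
  assumes "integrable leb01 g" "0 \<le> a" "b \<le> 1"
  shows "g integrable_on {a..b}"
proof -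
  have "g integrable_on {0..1}"
    using has_integral_integral_lebesgue_on[OF assms(1)] by (auto simp: integrable_on_def)
  then show ?thesis
    by (rule integrable_on_subinterval) (use assms in auto)
qed

lemma continuous_on_primitive:
  assumes "integrable leb01 g"
  shows "continuous_on {0..1} (primitive g)"
  unfolding primitive_def
  by (intro indefinite_integral_continuous_1 integrable_on_subinterval_leb01[OF assms]) auto

lemma primitive_diff_le:
  assumes g: "integrable leb01 g" and "x \<in> {0..1}" "y \<in> {0..1}"
  shows "cmod (primitive g y - primitive g x) \<le> (LINT z|leb01. cmod (g z))"
proof -
  have *: "cmod (primitive g y - primitive g x) \<le> (LINT z|leb01. cmod (g z))"
    if xy: "x \<in> {0..1}" "y \<in> {0..1}" "x \<le> y" for x y
  proof -
    have "integral {0..x} g + integral {x..y} g = integral {0..y} g"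
      using xy by (intro Henstock_Kurzweil_Integration.integral_combine integrable_on_subinterval_leb01[OF g]) auto
    then have "primitive g y - primitive g x = integral {x..y} g"
      unfolding primitive_def by (metis add_diff_cancel_left')
    also have "\<dots> = (LINT z|leb01. g z * of_real (indicat_real {x..y} z))"
      using xy by (intro integral_indicator_leb01(2)[OF g, symmetric]) auto
    also have "cmod \<dots> \<le> (LINT z|leb01. cmod (g z))"
    proof (rule Bochner_Integration.integral_norm_bound_integral)
      show "integrable leb01 (\<lambda>z. g z * of_real (indicat_real {x..y} z))"
      proof (rule Bochner_Integration.integrable_bound[OF g])
        show "(\<lambda>z. g z * of_real (indicat_real {x..y} z)) \<in> borel_measurable leb01"
          using g by (intro borel_measurable_times indicator_measurable_leb01) auto
      qed (simp add: norm_mult mult_left_le indicator_le_1)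
    qed (use g in \<open>auto simp: norm_mult intro!: mult_left_le indicator_le_1\<close>)
    finally show ?thesis .
  qed
  show ?thesis
    using *[of x y] *[of y x] assms by (cases "x \<le> y") (auto simp: norm_minus_commute)
qed

lemma integral_deriv_test_function:
  assumes \<phi>: "test_function \<phi>" and y: "y \<in> {0..1}"
  shows "(LINT x|leb01. complex_of_real (deriv \<phi> x) * of_real (indicat_real {y..1} x)) = - of_real (\<phi> y)"
proof -
  obtain a b where ab: "0 < a" "a < b" "b < 1" "\<And>x. x \<notin> {a..b} \<Longrightarrow> \<phi> x = 0"
    using \<phi> unfolding test_function_iff by blast
  have "integrable leb01 (\<lambda>x. 1 * complex_of_real (deriv \<phi> x))"
    using test_function_continuous[OF test_function_deriv[OF \<phi>]]
    by (intro integrable_mult_continuous) auto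
  then have "(LINT x|leb01. complex_of_real (deriv \<phi> x) * of_real (indicat_real {y..1} x)) =
      integral {y..1} (\<lambda>x. complex_of_real (deriv \<phi> x))"
    using y by (intro integral_indicator_leb01(2)) auto
  also have "\<dots> = of_real (\<phi> 1) - of_real (\<phi> y)"
  proof (rule integral_unique, rule fundamental_theorem_of_calculus)
    fix x :: real
    have "(\<phi> has_real_derivative deriv \<phi> x) (at x within {y..1})"
      by (rule has_field_derivative_at_within[OF smooth_on_UNIV_deriv(2)[OF test_function_smooth[OF \<phi>]]])
    then show "((\<lambda>x. complex_of_real (\<phi> x)) has_vector_derivative of_real (deriv \<phi> x)) (at x within {y..1})"
      by (rule has_vector_derivative_of_real)
  qed (use y in auto)
  also have "\<phi> 1 = 0" using ab by (intro ab(4)) auto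
  finally show ?thesis by simp
qed

text \<open>
Exchange the order of integration over the triangle \<open>0 \<le> y \<le> x \<le> 1\<close>; the inner integral of \<open>\<phi>'\<close>
from \<open>y\<close> to \<open>1\<close> is \<open>- \<phi> y\<close>.
\<close>

lemma weak_deriv_primitive:
  assumes g: "integrable leb01 g"
  shows "weak_deriv 1 (primitive g) g"
  unfolding weak_deriv_def
proof (intro allI impI)
  fix \<phi> assume \<phi>: "test_function \<phi>"
  note \<phi>' = test_function_deriv[OF \<phi>]
  interpret finite_measure leb01 by (rule finite_measure_lebesgue_on) auto
  interpret P: pair_sigma_finite leb01 leb01 by standard
  obtain M where M: "\<And>x. x \<in> {0..1} \<Longrightarrow> \<bar>deriv \<phi> x\<bar> \<le> M" "M \<ge> 0"
    using bounded_on_unit_interval[OF test_function_continuous[OF \<phi>']] by blast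
  define F where "F x y = g y * of_real (if y \<le> x then 1 else 0) * of_real (deriv \<phi> x)" for x y
  have [measurable]: "g \<in> borel_measurable leb01" using g by auto
  have [measurable]: "deriv \<phi> \<in> borel_measurable leb01"
    by (rule continuous_measurable_leb01[OF test_function_continuous[OF \<phi>']])
  have id[measurable]: "(\<lambda>x. x) \<in> borel_measurable leb01"
    by (rule continuous_measurable_leb01) (rule continuous_on_id)
  have "integrable (leb01 \<Otimes>\<^sub>M leb01) (\<lambda>(x, y). M * cmod (g y))"
    by (rule P.Fubini_integrable) (use g in auto)
  then have int: "integrable (leb01 \<Otimes>\<^sub>M leb01) (case_prod F)"
  proof (rule Bochner_Integration.integrable_bound)
    have [measurable]: "Measurable.pred (leb01 \<Otimes>\<^sub>M leb01) (\<lambda>p. snd p \<le> fst p)"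
      unfolding pred_def
      by (intro borel_measurable_le measurable_compose[OF measurable_fst id]
          measurable_compose[OF measurable_snd id])
    show "case_prod F \<in> borel_measurable (leb01 \<Otimes>\<^sub>M leb01)"
      unfolding F_def split_beta by measurable
    show "AE p in leb01 \<Otimes>\<^sub>M leb01. norm (case_prod F p) \<le> norm (case p of (x, y) \<Rightarrow> M * cmod (g y))"
    proof (rule AE_I2)
      fix p assume "p \<in> space (leb01 \<Otimes>\<^sub>M leb01)"
      then obtain x y where p: "p = (x, y)" "x \<in> {0..1}"
        by (auto simp: space_pair_measure)
      have "cmod (F x y) \<le> M * cmod (g y)"
        using mult_left_mono[OF M(1)[OF p(2)], of "cmod (g y)"] M(2)
        by (auto simp: F_def norm_mult mult.commute)
      then show "norm (case_prod F p) \<le> norm (case p of (x, y) \<Rightarrow> M * cmod (g y))"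
        using M(2) by (simp add: p)
    qed
  qed
  have "(LINT x|leb01. primitive g x * of_real (deriv \<phi> x)) = (LINT x|leb01. LINT y|leb01. F x y)"
  proof (rule Bochner_Integration.integral_cong[OF refl])
    fix x assume "x \<in> space leb01"
    then have x: "x \<in> {0..1}" by simp
    then have "primitive g x = (LINT y|leb01. g y * of_real (indicat_real {0..x} y))"
      unfolding primitive_def by (intro integral_indicator_leb01(2)[OF g, symmetric]) auto
    also have "\<dots> = (LINT y|leb01. g y * of_real (if y \<le> x then 1 else 0))"
      by (intro Bochner_Integration.integral_cong) (auto simp: indicator_def)
    finally show "primitive g x * of_real (deriv \<phi> x) = (LINT y|leb01. F x y)"
      by (simp add: F_def)
  qed
  also have "\<dots> = (LINT y|leb01. LINT x|leb01. F x y)"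
    by (rule P.Fubini_integral[OF int, symmetric])
  also have "\<dots> = (LINT y|leb01. - (g y * of_real (\<phi> y)))"
  proof (rule Bochner_Integration.integral_cong[OF refl])
    fix y assume "y \<in> space leb01"
    then have y: "y \<in> {0..1}" by simp
    have "(LINT x|leb01. F x y) = (LINT x|leb01. g y * (of_real (deriv \<phi> x) * of_real (indicat_real {y..1} x)))"
      by (intro Bochner_Integration.integral_cong) (auto simp: F_def indicator_def)
    also have "\<dots> = - (g y * of_real (\<phi> y))"
      using integral_deriv_test_function[OF \<phi> y] by simp
    finally show "(LINT x|leb01. F x y) = - (g y * of_real (\<phi> y))" .
  qed
  finally show "(LINT x|leb01. primitive g x * of_real ((deriv ^^ 1) \<phi> x)) =
      (-1) ^ 1 * (LINT x|leb01. g x * of_real (\<phi> x))"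
    by simp
qed

lemma continuous_L2: "continuous_on {0..1} f \<Longrightarrow> f \<in> L2"
proof -
  assume f: "continuous_on {0..1} f"
  have "integrable leb01 (\<lambda>x. (cmod (f x))\<^sup>2)"
    using f by (intro continuous_imp_integrable_real) (intro continuous_intros)
  with continuous_measurable_leb01[OF f] show ?thesis by (simp add: L2_def)
qed

text \<open>
The difference of \<open>f\<close> and the primitive of \<open>g\<close> has weak derivative zero, so it is constant.
\<close>

lemma weak_deriv_eq_primitive:
  assumes f: "f \<in> L2" and g: "g \<in> L2" and d: "weak_deriv 1 f g"
  shows "\<exists>c. AE x in leb01. f x = c + primitive g x"
proof -
  note gi = L2_integrable[OF g] and fi = L2_integrable[OF f]
  have pi: "integrable leb01 (primitive g)"
    by (intro L2_integrable continuous_L2 continuous_on_primitive gi)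
  have "\<exists>c. AE x in leb01. f x - primitive g x = c"
  proof (rule du_Bois_Reymond)
    show "integrable leb01 (\<lambda>x. f x - primitive g x)"
      using fi pi by simp
    fix \<phi> assume \<phi>: "test_function \<phi>"
    note i = integrable_mult_continuous[OF _ test_function_continuous[OF test_function_deriv[OF \<phi>]]]
    have "(LINT x|leb01. f x * of_real (deriv \<phi> x)) = (LINT x|leb01. primitive g x * of_real (deriv \<phi> x))"
      using d weak_deriv_primitive[OF gi] \<phi> by (simp add: weak_deriv_def)
    then show "(LINT x|leb01. (f x - primitive g x) * of_real (deriv \<phi> x)) = 0"
      using i[OF fi] i[OF pi] by (simp add: left_diff_distrib)
  qed
  then obtain c where "AE x in leb01. f x - primitive g x = c" ..
  then have "AE x in leb01. f x = c + primitive g x"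
    by (auto elim!: eventually_mono simp: algebra_simps)
  then show ?thesis ..
qed

lemma continuous_AE_eq:
  fixes f g :: "real \<Rightarrow> complex"
  assumes f: "continuous_on {0..1} f" and g: "continuous_on {0..1} g"
    and ae: "AE x in leb01. f x = g x" and p: "p \<in> {0..1}"
  shows "f p = g p"
proof -
  let ?h = "\<lambda>x. cmod (f x - g x)"
  have h: "continuous_on {0..1} ?h" by (intro continuous_intros f g)
  have "(LINT x|leb01. ?h x) = (LINT x|leb01. 0)"
    using ae continuous_measurable_leb01[OF h]
    by (intro integral_cong_AE) (auto elim: eventually_mono)
  then have "(LINT x|leb01. ?h x) = 0" by simp
  then have "\<forall>x\<in>{0..1}. ?h x = 0"
    using h by (subst (asm) integralL_eq_0_iff) auto
  with p show ?thesis by simp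
qed

lemma has_point_value_exists:
  assumes "f \<in> sobolev m" "m \<ge> 1"
  shows "\<exists>c. has_point_value f p c"
proof -
  obtain c where c: "AE x in leb01. f x = c + primitive (wderiv 1 f) x"
    using weak_deriv_eq_primitive[OF sobolev_L2[OF assms(1)] wderiv_sobolev[OF assms]] by blast
  have "continuous_on {0..1} (\<lambda>x. c + primitive (wderiv 1 f) x)"
    by (intro continuous_intros continuous_on_primitive L2_integrable wderiv_sobolev[OF assms])
  with c show ?thesis unfolding has_point_value_def by blast
qed

text \<open>
The one-dimensional trace inequality. The value at \<open>p\<close> differs from the value at any other point by at
most the \<open>L\<^sup>1\<close> norm of the derivative; averaging the squares over the other point gives the bound.
\<close>

lemma point_value_bound:
  assumes fm: "f \<in> sobolev m" "m \<ge> 1" and p: "p \<in> {0..1}" and fp: "has_point_value f p c"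
  shows "(cmod c)\<^sup>2 \<le> 2 * sobolev_sq m f"
proof -
  define g where "g = wderiv 1 f"
  have f: "f \<in> L2" and g: "g \<in> L2" "weak_deriv 1 f g"
    using sobolev_L2[OF fm(1)] wderiv_sobolev[OF fm] by (auto simp: g_def)
  note gi = L2_integrable[OF g(1)]
  obtain d where d: "AE x in leb01. f x = d + primitive g x"
    using weak_deriv_eq_primitive[OF f g] by blast
  have cont: "continuous_on {0..1} (\<lambda>x. d + primitive g x)"
    by (intro continuous_intros continuous_on_primitive gi)
  obtain r where r: "continuous_on {0..1} r" "AE x in leb01. f x = r x" "r p = c"
    using fp unfolding has_point_value_def by blast
  have "AE x in leb01. r x = d + primitive g x"
    using r(2) d by eventually_elim simp
  from continuous_AE_eq[OF r(1) cont this p] r(3) have c: "c = d + primitive g p" by simp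
  define I where "I = (LINT z|leb01. cmod (g z))"
  have "AE x in leb01. (cmod c)\<^sup>2 \<le> 2 * (cmod (f x))\<^sup>2 + 2 * I\<^sup>2"
  proof -
    have "AE x in leb01. x \<in> {0..1}" by (rule leb01_AE_space)
    with d show ?thesis
    proof eventually_elim
      case (elim x)
      have "c = f x + (primitive g p - primitive g x)" using c elim(1) by simp
      moreover have "cmod (primitive g p - primitive g x) \<le> I"
        unfolding I_def by (rule primitive_diff_le[OF gi elim(2) p])
      then have "(cmod (primitive g p - primitive g x))\<^sup>2 \<le> I\<^sup>2"
        by (intro power_mono) auto
      ultimately show ?case
        using square_norm_add_le[of "f x" "primitive g p - primitive g x"] by simp
    qed
  qed
  then have "(LINT x|leb01. (cmod c)\<^sup>2) \<le> (LINT x|leb01. 2 * (cmod (f x))\<^sup>2 + 2 * I\<^sup>2)"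
    using L2_integrable_square[OF f] by (intro integral_mono_AE) auto
  also have "\<dots> = 2 * L2_sq f + 2 * I\<^sup>2"
    using L2_integrable_square[OF f] by (simp add: L2_sq_def integral_const_leb01 del: lebesgue_integral_const)
  also have "I\<^sup>2 \<le> L2_sq g"
    unfolding I_def L2_sq_def by (rule integral_square_norm_le[OF g(1)])
  finally have "(LINT x|leb01. (cmod c)\<^sup>2) \<le> 2 * L2_sq f + 2 * L2_sq g"
    by (simp del: lebesgue_integral_const)
  then have "(cmod c)\<^sup>2 \<le> 2 * (L2_sq f + L2_sq g)"
    by (simp only: integral_const_leb01 distrib_left)
  also have "L2_sq f + L2_sq g = sobolev_sq (Suc 0) f"
    using sobolev_sq_Suc[OF g(2), of 0] sobolev_sq_0[OF g(1)] sobolev_mono[OF fm(1)] fm(2) by simp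
  also have "\<dots> \<le> sobolev_sq m f"
    using fm(2) by (intro sobolev_sq_mono) simp
  finally show ?thesis by simp
qed

lemma has_point_value_add:
  assumes "has_point_value f p c" "has_point_value g p d"
  shows "has_point_value (\<lambda>x. f x + g x) p (c + d)"
proof -
  obtain r s where "continuous_on {0..1} r" "AE x in leb01. f x = r x" "r p = c"
    "continuous_on {0..1} s" "AE x in leb01. g x = s x" "s p = d"
    using assms unfolding has_point_value_def by blast
  then show ?thesis
    unfolding has_point_value_def
    by (intro exI[of _ "\<lambda>x. r x + s x"]) (auto intro: continuous_on_add elim: eventually_elim2)
qed

lemma has_point_value_cmult:
  assumes "has_point_value f p c"
  shows "has_point_value (\<lambda>x. a * f x) p (a * c)"
proof -
  obtain r where "continuous_on {0..1} r" "AE x in leb01. f x = r x" "r p = c"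
    using assms unfolding has_point_value_def by blast
  then show ?thesis
    unfolding has_point_value_def
    by (intro exI[of _ "\<lambda>x. a * r x"]) (auto intro: continuous_on_mult_left elim: eventually_mono)
qed

lemma has_point_value_cong:
  assumes "has_point_value f p c" "AE x in leb01. f x = g x"
  shows "has_point_value g p c"
proof -
  obtain r where r: "continuous_on {0..1} r" "AE x in leb01. f x = r x" "r p = c"
    using assms unfolding has_point_value_def by blast
  have "AE x in leb01. g x = r x"
    using r(2) assms(2) by eventually_elim simp
  with r show ?thesis unfolding has_point_value_def by blast
qed

section \<open>The evolution\<close>

lemma schroedinger_op_cong:
  assumes "f \<in> L2" "AE x in leb01. f x = g x"
  shows "AE x in leb01. schroedinger_op V f x = schroedinger_op V g x"
  unfolding schroedinger_op_def wderiv_cong[OF assms]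
  using assms(2) by eventually_elim simp

lemma schroedinger_op_linear:
  assumes "f \<in> sobolev 2" "g \<in> sobolev 2"
  shows "AE x in leb01. schroedinger_op V (\<lambda>x. a * f x + b * g x) x =
    a * schroedinger_op V f x + b * schroedinger_op V g x"
  using wderiv_add[OF sobolev_cmult[OF assms(1)] sobolev_cmult[OF assms(2)] order_refl, of a b]
    wderiv_cmult[OF assms(1) order_refl, of a] wderiv_cmult[OF assms(2) order_refl, of b]
  by eventually_elim (simp add: schroedinger_op_def algebra_simps)

text \<open>
The operator \<open>B\<close> for which the equation reads \<open>\<partial>\<^sub>t u = B u\<close>.
\<close>

definition generator :: "(real \<Rightarrow> real) \<Rightarrow> (real \<Rightarrow> complex) \<Rightarrow> real \<Rightarrow> complex"
  where "generator V f = (\<lambda>x. - \<i> * schroedinger_op V f x)"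

lemma generator_linear:
  assumes "f \<in> sobolev 2" "g \<in> sobolev 2"
  shows "AE x in leb01. generator V (\<lambda>x. a * f x + b * g x) x = a * generator V f x + b * generator V g x"
  using schroedinger_op_linear[OF assms, of V a b]
  by eventually_elim (simp add: generator_def algebra_simps)

lemma generator_bounded:
  assumes "smooth_on {0..1} V"
  obtains C where "C \<ge> 0" "\<And>f. f \<in> sobolev (m + 2) \<Longrightarrow> generator V f \<in> sobolev m"
    "\<And>f. f \<in> sobolev (m + 2) \<Longrightarrow> sobolev_sq m (generator V f) \<le> C * sobolev_sq (m + 2) f"
proof -
  obtain C where C: "C \<ge> 0" "\<And>f. f \<in> sobolev (m + 2) \<Longrightarrow> schroedinger_op V f \<in> sobolev m"
    "\<And>f. f \<in> sobolev (m + 2) \<Longrightarrow> sobolev_sq m (schroedinger_op V f) \<le> C * sobolev_sq (m + 2) f"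
    using schroedinger_op_bounded[OF assms] by blast
  have "sobolev_sq m (generator V f) \<le> C * sobolev_sq (m + 2) f" if "f \<in> sobolev (m + 2)" for f
    unfolding generator_def sobolev_sq_cmult[OF C(2)[OF that]] using C(3)[OF that] by simp
  moreover have "generator V f \<in> sobolev m" if "f \<in> sobolev (m + 2)" for f
    unfolding generator_def by (rule sobolev_cmult[OF C(2)[OF that]])
  ultimately show thesis using C(1) that by blast
qed

lemma sobolev_norm_tendsto_0_iff:
  "((\<lambda>s. sobolev_norm m (f s)) \<longlongrightarrow> 0) F \<longleftrightarrow> ((\<lambda>s. sobolev_sq m (f s)) \<longlongrightarrow> 0) F"
proof
  assume "((\<lambda>s. sobolev_norm m (f s)) \<longlongrightarrow> 0) F"
  then have "((\<lambda>s. (sobolev_norm m (f s))\<^sup>2) \<longlongrightarrow> 0\<^sup>2) F" by (rule tendsto_power)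
  then show "((\<lambda>s. sobolev_sq m (f s)) \<longlongrightarrow> 0) F"
    by (simp add: sobolev_norm_eq_sqrt sobolev_sq_nonneg)
next
  assume "((\<lambda>s. sobolev_sq m (f s)) \<longlongrightarrow> 0) F"
  then have "((\<lambda>s. sqrt (sobolev_sq m (f s))) \<longlongrightarrow> sqrt 0) F" by (rule tendsto_real_sqrt)
  then show "((\<lambda>s. sobolev_norm m (f s)) \<longlongrightarrow> 0) F"
    by (simp add: sobolev_norm_eq_sqrt)
qed

lemma sobolev_sq_tendsto_0_le:
  assumes "((\<lambda>s. sobolev_sq m (f s)) \<longlongrightarrow> 0) F"
    and "\<And>s. sobolev_sq n (g s) \<le> C * sobolev_sq m (f s)"
  shows "((\<lambda>s. sobolev_sq n (g s)) \<longlongrightarrow> 0) F"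
proof (rule tendsto_sandwich[where f = "\<lambda>_. 0"])
  show "((\<lambda>s. C * sobolev_sq m (f s)) \<longlongrightarrow> 0) F"
    using tendsto_mult_left[OF assms(1), of C] by simp
qed (use assms(2) in \<open>auto simp: sobolev_sq_nonneg\<close>)

text \<open>
Brings the expression that defines \<open>has_time_deriv\<close> into the form to which the linearity rules apply.
At \<open>c = 0\<close> both sides agree because \<open>inverse 0 = 0\<close>.
\<close>

lemma difference_quotient_eq_lincomb:
  "(\<lambda>x. (f x - g x) / c - v x) = (\<lambda>x. 1 * (inverse c * f x + - inverse c * g x) + -1 * v x)"
  for f g v :: "real \<Rightarrow> complex"
  by (simp add: divide_inverse algebra_simps)

lemma difference_quotient_sobolev:
  assumes "f \<in> sobolev m" "g \<in> sobolev m" "v \<in> sobolev m"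
  shows "(\<lambda>x. (f x - g x) / c - v x) \<in> sobolev m"
  unfolding difference_quotient_eq_lincomb by (intro sobolev_add sobolev_cmult assms)

lemma generator_difference_quotient:
  assumes "f \<in> sobolev 2" "g \<in> sobolev 2" "v \<in> sobolev 2"
  shows "AE x in leb01. generator V (\<lambda>x. (f x - g x) / c - v x) x =
    (generator V f x - generator V g x) / c - generator V v x"
proof -
  have "(\<lambda>x. inverse c * f x + - inverse c * g x) \<in> sobolev 2"
    by (intro sobolev_add sobolev_cmult assms)
  from generator_linear[OF this assms(3), of V 1 "-1"]
    generator_linear[OF assms(1,2), of V "inverse c" "- inverse c"]
  show ?thesis
    unfolding difference_quotient_eq_lincomb
  proof eventually_elim
    case (elim x)
    show ?case
      unfolding elim by (simp add: divide_inverse algebra_simps)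
  qed
qed

lemma has_time_deriv_iff:
  "has_time_deriv m u v t \<longleftrightarrow>
    ((\<lambda>s. sobolev_sq m (\<lambda>x. (u s x - u t x) / of_real (s - t) - v x)) \<longlongrightarrow> 0) (at t)"
  unfolding has_time_deriv_def by (rule sobolev_norm_tendsto_0_iff)

lemma has_time_deriv_mono:
  assumes "has_time_deriv m u v t" "n \<le> m"
  shows "has_time_deriv n u v t"
  using assms(1) unfolding has_time_deriv_iff
  by (rule sobolev_sq_tendsto_0_le[where C = 1]) (use sobolev_sq_mono[OF assms(2)] in simp)

lemma has_time_deriv_cong:
  assumes "has_time_deriv m u v t" "AE x in leb01. v x = w x" "\<And>s. u s \<in> L2" "v \<in> L2"
  shows "has_time_deriv m u w t"
proof -
  have "sobolev_sq m (\<lambda>x. (u s x - u t x) / of_real (s - t) - v x) =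
      sobolev_sq m (\<lambda>x. (u s x - u t x) / of_real (s - t) - w x)" for s
  proof (rule sobolev_sq_cong)
    show "(\<lambda>x. (u s x - u t x) / of_real (s - t) - v x) \<in> L2"
      using difference_quotient_sobolev[of _ 0] assms(3,4) by (simp add: sobolev_0)
    show "AE x in leb01. (u s x - u t x) / of_real (s - t) - v x = (u s x - u t x) / of_real (s - t) - w x"
      using assms(2) by eventually_elim simp
  qed
  with assms(1) show ?thesis by (simp add: has_time_deriv_iff)
qed

text \<open>
By linearity the error of the difference quotient of \<open>B u\<close> is \<open>B\<close> applied to the error of the
difference quotient of \<open>u\<close>, and \<open>B\<close> is bounded.
\<close>

lemma has_time_deriv_generator:
  assumes V: "smooth_on {0..1} V" and u: "\<And>s. u s \<in> sobolev (m + 2)" and v: "v \<in> sobolev (m + 2)"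
    and d: "has_time_deriv (m + 2) u v t"
  shows "has_time_deriv m (\<lambda>s. generator V (u s)) (generator V v) t"
proof -
  obtain C where C: "\<And>f. f \<in> sobolev (m + 2) \<Longrightarrow> generator V f \<in> sobolev m"
    "\<And>f. f \<in> sobolev (m + 2) \<Longrightarrow> sobolev_sq m (generator V f) \<le> C * sobolev_sq (m + 2) f"
    using generator_bounded[OF V] by metis
  define q where "q s = (\<lambda>x. (u s x - u t x) / of_real (s - t) - v x)" for s
  have q: "q s \<in> sobolev (m + 2)" for s
    unfolding q_def by (intro difference_quotient_sobolev u v)
  have "sobolev_sq m (\<lambda>x. (generator V (u s) x - generator V (u t) x) / of_real (s - t) - generator V v x)
      = sobolev_sq m (generator V (q s))" for s
    unfolding q_def using C(1)[OF q[of s, unfolded q_def]] sobolev_mono[OF u] sobolev_mono[OF v]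
    by (intro sobolev_sq_cong[symmetric] generator_difference_quotient) (auto intro: sobolev_L2)
  moreover have "((\<lambda>s. sobolev_sq m (generator V (q s))) \<longlongrightarrow> 0) (at t)"
    using d unfolding has_time_deriv_iff
    by (rule sobolev_sq_tendsto_0_le) (fold q_def, rule C(2)[OF q])
  ultimately show ?thesis by (simp add: has_time_deriv_iff)
qed

lemma continuous_generator:
  assumes V: "smooth_on {0..1} V" and u: "\<And>s. u s \<in> sobolev (m + 2)"
    and c: "((\<lambda>s. sobolev_sq (m + 2) (\<lambda>x. u s x - u t x)) \<longlongrightarrow> 0) (at t)"
  shows "((\<lambda>s. sobolev_sq m (\<lambda>x. generator V (u s) x - generator V (u t) x)) \<longlongrightarrow> 0) (at t)"
proof -
  obtain C where C: "\<And>f. f \<in> sobolev (m + 2) \<Longrightarrow> generator V f \<in> sobolev m"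
    "\<And>f. f \<in> sobolev (m + 2) \<Longrightarrow> sobolev_sq m (generator V f) \<le> C * sobolev_sq (m + 2) f"
    using generator_bounded[OF V] by metis
  define q where "q s = (\<lambda>x. u s x - u t x)" for s
  have q_eq: "q s = (\<lambda>x. 1 * u s x + -1 * u t x)" for s
    by (simp add: q_def)
  have q: "q s \<in> sobolev (m + 2)" for s
    unfolding q_eq by (intro sobolev_add sobolev_cmult u)
  have "sobolev_sq m (\<lambda>x. generator V (u s) x - generator V (u t) x) = sobolev_sq m (generator V (q s))" for s
  proof (rule sobolev_sq_cong[symmetric, OF sobolev_L2[OF C(1)[OF q]]])
    have "u r \<in> sobolev 2" for r using sobolev_mono[OF u] by simp
    from generator_linear[OF this[of s] this[of t], of V 1 "-1"]
    show "AE x in leb01. generator V (q s) x = generator V (u s) x - generator V (u t) x"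
      unfolding q_eq by eventually_elim simp
  qed
  moreover have "((\<lambda>s. sobolev_sq m (generator V (q s))) \<longlongrightarrow> 0) (at t)"
    using c by (rule sobolev_sq_tendsto_0_le) (fold q_def, rule C(2)[OF q])
  ultimately show ?thesis by simp
qed

text \<open>
The difference quotients vanish at \<open>p\<close> and converge to \<open>v\<close> in a norm that controls the value at \<open>p\<close>.
\<close>

lemma has_time_deriv_point_value_0:
  assumes u: "\<And>s. u s \<in> sobolev m" and v: "v \<in> sobolev m" and m: "m \<ge> 1"
    and d: "has_time_deriv m u v t"
    and p: "p \<in> {0..1}" and u0: "\<And>s. has_point_value (u s) p 0"
  shows "has_point_value v p 0"
proof -
  obtain c where c: "has_point_value v p c"
    using has_point_value_exists[OF v m] by blast
  have le: "(cmod c)\<^sup>2 \<le> 2 * sobolev_sq m (\<lambda>x. (u s x - u t x) / of_real (s - t) - v x)" for s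
  proof -
    let ?a = "inverse (of_real (s - t)) :: complex"
    have "has_point_value (\<lambda>x. (u s x - u t x) / of_real (s - t) - v x) p
        (1 * (?a * 0 + - ?a * 0) + -1 * c)"
      unfolding difference_quotient_eq_lincomb
      by (intro has_point_value_add has_point_value_cmult u0 c)
    from point_value_bound[OF difference_quotient_sobolev[OF u u v] m p this] show ?thesis by simp
  qed
  have "((\<lambda>s. 2 * sobolev_sq m (\<lambda>x. (u s x - u t x) / of_real (s - t) - v x)) \<longlongrightarrow> 2 * 0) (at t)"
    using d unfolding has_time_deriv_iff by (intro tendsto_mult_left)
  then have "(cmod c)\<^sup>2 \<le> 2 * 0"
    by (rule tendsto_lowerbound) (use le in auto)
  then have "c = 0" by simp
  with c show ?thesis by simp
qed

theorem proposition2p1: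
  fixes V :: "real \<Rightarrow> real" and k :: nat and u :: "real \<Rightarrow> real \<Rightarrow> complex"
  assumes "smooth_on {0..1} V"
    and "k \<ge> 1"
    and "u \<in> C_time 0 (sobolev (2 * k)) (2 * k)"
    and "u \<in> C_time 1 (sobolev (2 * k - 2)) (2 * k - 2)"
    and "\<And>t. AE x in leb01. \<i> * time_deriv (2 * k - 2) u t x = schroedinger_op V (u t) x"
    and "\<And>t. has_point_value (u t) 0 0" and "\<And>t. has_point_value (u t) 1 0"
  shows "\<forall>j\<le>k. u \<in> C_time j (sobolev_V V (k - j)) (2 * (k - j))"
proof -
  note V = assms(1)
  define D where "D i t = (generator V ^^ i) (u t)" for i t
  have D_0: "D 0 = u" and D_Suc: "D (Suc i) t = generator V (D i t)" for i t
    by (auto simp: D_def)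

  have u_sobolev: "u t \<in> sobolev (2 * k)"
    and u_continuous: "((\<lambda>s. sobolev_sq (2 * k) (\<lambda>x. u s x - u t x)) \<longlongrightarrow> 0) (at t)" for t
    using assms(3) by (auto simp: C_time_def sobolev_norm_tendsto_0_iff)
  have u_deriv: "has_time_deriv (2 * k - 2) u (generator V (u t)) t" for t
  proof -
    have "\<exists>v. v \<in> sobolev (2 * k - 2) \<and> has_time_deriv (2 * k - 2) u v t"
      using assms(4) unfolding C_time_def by auto
    from someI_ex[OF this] have w: "time_deriv (2 * k - 2) u t \<in> sobolev (2 * k - 2)"
      "has_time_deriv (2 * k - 2) u (time_deriv (2 * k - 2) u t) t"
      by (auto simp: time_deriv_def)
    have "AE x in leb01. time_deriv (2 * k - 2) u t x = generator V (u t) x"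
      using assms(5)[of t]
    proof eventually_elim
      case (elim x)
      then have "- \<i> * (\<i> * time_deriv (2 * k - 2) u t x) = generator V (u t) x"
        by (simp add: generator_def)
      then show ?case by (simp flip: mult.assoc)
    qed
    from has_time_deriv_cong[OF w(2) this] show ?thesis
      using sobolev_L2[OF u_sobolev] sobolev_L2[OF w(1)] by blast
  qed

  have D_sobolev: "D i t \<in> sobolev (2 * (k - i))" if "i \<le> k" for i t
    using that
  proof (induction i)
    case (Suc i)
    then have "2 * (k - i) = 2 * (k - Suc i) + 2" by simp
    with Suc show ?case
      unfolding D_Suc using generator_bounded[OF V, of "2 * (k - Suc i)"] by (metis Suc_leD)
  qed (simp add: D_0 u_sobolev)

  have D_continuous: "((\<lambda>s. sobolev_sq (2 * (k - i)) (\<lambda>x. D i s x - D i t x)) \<longlongrightarrow> 0) (at t)"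
    if "i \<le> k" for i t
    using that
  proof (induction i)
    case (Suc i)
    then have "2 * (k - i) = 2 * (k - Suc i) + 2" by simp
    with Suc D_sobolev[of i] show ?case
      unfolding D_Suc by (intro continuous_generator[OF V]) auto
  qed (simp add: D_0 u_continuous)

  have D_deriv: "has_time_deriv (2 * (k - Suc i)) (D i) (D (Suc i) t) t" if "i < k" for i t
    using that
  proof (induction i)
    case 0
    then show ?case using u_deriv[of t] by (simp add: D_0 D_Suc right_diff_distrib')
  next
    case (Suc i)
    then have eq: "2 * (k - Suc i) = 2 * (k - Suc (Suc i)) + 2" by simp
    have s: "D i s \<in> sobolev (2 * (k - Suc (Suc i)) + 2)" for s
      using sobolev_mono[OF D_sobolev[of i s], of "2 * (k - Suc i)"] Suc.prems eq by simp
    have v: "D (Suc i) t \<in> sobolev (2 * (k - Suc (Suc i)) + 2)"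
      using D_sobolev[of "Suc i" t] Suc.prems eq by simp
    have "has_time_deriv (2 * (k - Suc (Suc i)) + 2) (D i) (D (Suc i) t) t"
      using Suc eq by simp
    from has_time_deriv_generator[OF V s v this] show ?case
      by (simp add: D_def)
  qed

  have D_boundary: "has_point_value (D i t) p 0" if "i < k" "p \<in> {0, 1}" for i t p
    using that
  proof (induction i arbitrary: t)
    case 0
    then show ?case using assms(6,7) by (auto simp: D_0)
  next
    case (Suc i)
    show ?case
    proof (rule has_time_deriv_point_value_0)
      show "has_time_deriv (2 * (k - Suc i)) (D i) (D (Suc i) t) t"
        using D_deriv Suc.prems by simp
      show "D i s \<in> sobolev (2 * (k - Suc i))" for s
        using sobolev_mono[OF D_sobolev[of i s]] Suc.prems by simp
      show "D (Suc i) t \<in> sobolev (2 * (k - Suc i))"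
        using D_sobolev Suc.prems by simp
    qed (use Suc in auto)
  qed

  \<comment> \<open>The generator absorbs one factor \<open>- \<i>\<close> at each step.\<close>
  have power_op: "AE x in leb01. (schroedinger_op V ^^ l) (D i t) x = \<i> ^ l * D (i + l) t x"
    if "i + l \<le> k" for i l t
    using that
  proof (induction l)
    case (Suc l)
    let ?w = "\<lambda>x. \<i> ^ l * D (i + l) t x"
    have D2: "D (i + l) t \<in> sobolev 2"
      using sobolev_mono[OF D_sobolev[of "i + l" t], of 2] Suc.prems by simp
    have "AE x in leb01. ?w x = (schroedinger_op V ^^ l) (D i t) x"
      using Suc by (auto elim: eventually_mono)
    from schroedinger_op_cong[OF L2_cmult[OF sobolev_L2[OF D2]] this, of V]
      schroedinger_op_linear[OF D2 D2, of V "\<i> ^ l" 0]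
    show ?case
      by eventually_elim (simp add: D_Suc generator_def mult.assoc mult.left_commute[of "\<i> ^ l" \<i>])
  qed simp

  show ?thesis
  proof (intro allI impI)
    fix j assume j: "j \<le> k"
    \<comment> \<open>As \<open>i \<le> j\<close>, only \<open>D (i + l)\<close> with \<open>i + l < k\<close> occur in the boundary conditions.\<close>
    have "D i t \<in> sobolev_V V (k - j)" if "i \<le> j" for i t
      unfolding sobolev_V_def
    proof (intro CollectI conjI allI impI)
      show "D i t \<in> sobolev (2 * (k - j))"
        using sobolev_mono[OF D_sobolev[of i t]] that j by simp
      fix l assume "l < k - j"
      then have l: "i + l < k" using that by simp
      have "has_point_value ((schroedinger_op V ^^ l) (D i t)) p 0" if "p \<in> {0, 1}" for p
      proof (rule has_point_value_cong)
        show "has_point_value (\<lambda>x. \<i> ^ l * D (i + l) t x) p 0"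
          using has_point_value_cmult[OF D_boundary[OF l that]] by simp
        show "AE x in leb01. \<i> ^ l * D (i + l) t x = (schroedinger_op V ^^ l) (D i t) x"
          using power_op[of i l t] l by (auto elim: eventually_mono)
      qed
      then show "has_point_value ((schroedinger_op V ^^ l) (D i t)) 0 0"
        "has_point_value ((schroedinger_op V ^^ l) (D i t)) 1 0" by auto
    qed
    moreover have "((\<lambda>s. sobolev_norm (2 * (k - j)) (\<lambda>x. D i s x - D i t x)) \<longlongrightarrow> 0) (at t)"
      if "i \<le> j" for i t
      unfolding sobolev_norm_tendsto_0_iff
    proof (rule sobolev_sq_tendsto_0_le[where C = 1])
      show "((\<lambda>s. sobolev_sq (2 * (k - i)) (\<lambda>x. D i s x - D i t x)) \<longlongrightarrow> 0) (at t)"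
        using D_continuous[of i t] that j by simp
      show "sobolev_sq (2 * (k - j)) (\<lambda>x. D i s x - D i t x) \<le>
          1 * sobolev_sq (2 * (k - i)) (\<lambda>x. D i s x - D i t x)" for s
        using that by (simp add: sobolev_sq_mono)
    qed
    moreover have "has_time_deriv (2 * (k - j)) (D i) (D (Suc i) t) t" if "i < j" for i t
      using has_time_deriv_mono[OF D_deriv[of i t], of "2 * (k - j)"] that j by simp
    ultimately show "u \<in> C_time j (sobolev_V V (k - j)) (2 * (k - j))"
      unfolding C_time_def by (intro CollectI exI[of _ D] conjI allI impI D_0)
  qed
qed

end
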